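(* There exist universal constants $c,C_1,C_2,c_0>0$ such that the following holds. Let $\delta\in[0,1/4)$, $p\ge 1$, and $\varepsilon,\eta>0$. Let $R,P$ be arbitrary probability distributions over $\mathbb{R}^n$ satisfying $\mathcal{W}_p(R,P)\le\varepsilon$. Let $x^*\sim R$ and suppose $y$ is generated from $x^*$ by a Gaussian measurement process with noise level $\sigma\ge C_1\,\varepsilon/\delta^{1/p}$ and $$m\ \ge\ C_2\min\left(\log \mathrm{Cov}_{\eta,\delta}(R),\ \log \mathrm{Cov}_{\eta,\delta}(P)\right)$$ measurements. Given $y$ and the matrix $A$, let $\widehat{x}$ be the output of posterior sampling with respect to $P$, i.e. $\widehat{x}\sim P(\cdot\mid y,A)$. Then, with probability at least $1-e^{-c_0 m}$ over $A,\xi$, $$\Pr_{x^*\sim R,\ \widehat{x}\sim P(\cdot\mid y,A)}\left[\|x^*-\widehat{x}\|\ge c\,\eta+c\,\sigma\right]\le 2\delta+2e^{-c_0 m}.$$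
   Context: $\|\cdot\|$ is the $\ell_2$ norm. Approximate covering number: for a probability distribution $R$ on $\mathbb{R}^n$, $\eta>0$ and $\delta\in[0,1]$, $\mathrm{Cov}_{\eta,\delta}(R)=\min\{k: R[\cup_{i=1}^k\mathcal{B}(x_i,\eta)]\ge 1-\delta \text{ for some } x_1,\dots,x_k\in\mathbb{R}^n\}$ (and $+\infty$ if no such $k$ exists), where $\mathcal{B}(x,\eta)$ is the closed $\ell_2$ ball of radius $\eta$ centered at $x$. Wasserstein distance: $\mathcal{W}_p(\mu,\nu)=\inf_{\gamma\in\Pi(\mu,\nu)}\left(\mathbb{E}_{(u,v)\sim\gamma}\|u-v\|^p\right)^{1/p}$, where $\Pi(\mu,\nu)$ is the set of couplings of $\mu$ and $\nu$. Gaussian measurement process: $y$ is generated from $x^*\in\mathbb{R}^n$ by a Gaussian measurement process with $m\ge1$ measurements and noise level $\sigma$ if $y=Ax^*+\xi$, where $A\in\mathbb{R}^{m\times n}$ has i.i.d. entries $A_{ij}\sim\mathcal{N}(0,1/m)$ and $\xi\sim\mathcal{N}(0,\frac{\sigma^2}{m}I_m)$, with $x^*,A,\xi$ independent. Posterior sampling with respect to $P$: given $y$ and $A$, output $\widehat{x}\sim P(\cdot\mid y,A)$, the posterior distribution of $x$ given $y$ under the model $x\sim P$, $y=Ax+\xi$; that is, $P(dx\mid y,A)\propto\exp\left(-\frac{m\|y-Ax\|^2}{2\sigma^2}\right)P(dx)$. Given $(y,A)$, $\widehat{x}$ is drawn independently of $x^*$. When $\delta=0$, the quantity $\varepsilon/\delta^{1/p}$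 is understood as $+\infty$ (so the hypothesis on $\sigma$ cannot hold). In the inner probability of the conclusion, $A$ and $\xi$ are held fixed. *)

theory Defs
  imports "HOL-Probability.Probability" "HOL-Library.Extended_Nat"
begin

(* The dimensions n and m vary inside the scope of constants independent of them, so they cannot be
   type-level: \<real>^n is the space of PiM {..<n} (\<lambda>_. borel), i.e. functions nat \<Rightarrow> real that are
   extensional on {..<n}, and its probability distributions are the elements of
   space (prob_algebra (Rn n)). *)

definition Rn :: "nat \<Rightarrow> (nat \<Rightarrow> real) measure" where
  "Rn n = Pi\<^sub>M {..<n} (\<lambda>_. borel)"

definition l2_dist :: "nat \<Rightarrow> (nat \<Rightarrow> real) \<Rightarrow> (nat \<Rightarrow> real) \<Rightarrow> real" where
  "l2_dist n u v = L2_set (\<lambda>i. u i - v i) {..<n}"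

definition l2_ball :: "nat \<Rightarrow> (nat \<Rightarrow> real) \<Rightarrow> real \<Rightarrow> (nat \<Rightarrow> real) set" where
  "l2_ball n x r = {z \<in> space (Rn n). l2_dist n x z \<le> r}"

(* The infimum of the empty set of extended naturals is \<infinity>; a nonempty infimum is attained. *)
definition Cov :: "nat \<Rightarrow> real \<Rightarrow> real \<Rightarrow> (nat \<Rightarrow> real) measure \<Rightarrow> enat" where
  "Cov n \<eta> \<delta> R = Inf {enat k | k. \<exists>x. (\<forall>i<k. x i \<in> space (Rn n)) \<and>
     measure R (\<Union>i<k. l2_ball n (x i) \<eta>) \<ge> 1 - \<delta>}"

fun ln_enat :: "enat \<Rightarrow> ereal" where
  "ln_enat (enat k) = (if k = 0 then -\<infinity> else ereal (ln (real k)))"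
| "ln_enat \<infinity> = \<infinity>"

(* a-th power on [0,\<infinity>], for a > 0 *)
definition ennpowr :: "ennreal \<Rightarrow> real \<Rightarrow> ennreal" where
  "ennpowr x a = (if x = \<infinity> then \<infinity> else ennreal (enn2real x powr a))"

definition couplings ::
  "nat \<Rightarrow> (nat \<Rightarrow> real) measure \<Rightarrow> (nat \<Rightarrow> real) measure \<Rightarrow> ((nat \<Rightarrow> real) \<times> (nat \<Rightarrow> real)) measure set" where
  "couplings n \<mu> \<nu> = {\<gamma> \<in> space (prob_algebra (Rn n \<Otimes>\<^sub>M Rn n)).
     distr \<gamma> (Rn n) fst = \<mu> \<and> distr \<gamma> (Rn n) snd = \<nu>}"

definition wasserstein ::
  "nat \<Rightarrow> real \<Rightarrow> (nat \<Rightarrow> real) measure \<Rightarrow> (nat \<Rightarrow> real) measure \<Rightarrow> ennreal" where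
  "wasserstein n p \<mu> \<nu> =
     (INF \<gamma>\<in>couplings n \<mu> \<nu>. ennpowr (\<integral>\<^sup>+(u, v). ennreal (l2_dist n u v powr p) \<partial>\<gamma>) (1 / p))"

(* An m \<times> n matrix is a function on index pairs (row, column). The second argument of
   normal_density is the standard deviation, not the variance. *)
definition gaussian_matrix :: "nat \<Rightarrow> nat \<Rightarrow> (nat \<times> nat \<Rightarrow> real) measure" where
  "gaussian_matrix m n =
     Pi\<^sub>M ({..<m} \<times> {..<n}) (\<lambda>_. density lborel (normal_density 0 (sqrt (1 / real m))))"

definition gaussian_noise :: "nat \<Rightarrow> real \<Rightarrow> (nat \<Rightarrow> real) measure" where
  "gaussian_noise m \<sigma> =
     Pi\<^sub>M {..<m} (\<lambda>_. density lborel (normal_density 0 (sqrt (\<sigma>\<^sup>2 / real m))))"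

definition matvec :: "nat \<Rightarrow> nat \<Rightarrow> (nat \<times> nat \<Rightarrow> real) \<Rightarrow> (nat \<Rightarrow> real) \<Rightarrow> nat \<Rightarrow> real" where
  "matvec m n A x = (\<lambda>i\<in>{..<m}. \<Sum>j<n. A (i, j) * x j)"

definition measurement ::
  "nat \<Rightarrow> nat \<Rightarrow> (nat \<times> nat \<Rightarrow> real) \<Rightarrow> (nat \<Rightarrow> real) \<Rightarrow> (nat \<Rightarrow> real) \<Rightarrow> nat \<Rightarrow> real" where
  "measurement m n A \<xi> x = (\<lambda>i\<in>{..<m}. matvec m n A x i + \<xi> i)"

definition likelihood ::
  "nat \<Rightarrow> nat \<Rightarrow> real \<Rightarrow> (nat \<times> nat \<Rightarrow> real) \<Rightarrow> (nat \<Rightarrow> real) \<Rightarrow> (nat \<Rightarrow> real) \<Rightarrow> real" where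
  "likelihood m n \<sigma> A y x =
     exp (- (real m * (l2_dist m y (matvec m n A x))\<^sup>2 / (2 * \<sigma>\<^sup>2)))"

definition posterior ::
  "nat \<Rightarrow> nat \<Rightarrow> real \<Rightarrow> (nat \<Rightarrow> real) measure \<Rightarrow> (nat \<Rightarrow> real) \<Rightarrow> (nat \<times> nat \<Rightarrow> real)
     \<Rightarrow> (nat \<Rightarrow> real) measure" where
  "posterior m n \<sigma> P y A =
     density P (\<lambda>x. ennreal (likelihood m n \<sigma> A y x)
                     / (\<integral>\<^sup>+x'. ennreal (likelihood m n \<sigma> A y x') \<partial>P))"

(* Law of (x*, xhat) for fixed A and \<xi>: x* ~ R, y = A x* + \<xi>, and then xhat ~ P(. | y, A). *)
definition sampling_law ::
  "nat \<Rightarrow> nat \<Rightarrow> real \<Rightarrow> (nat \<Rightarrow> real) measure \<Rightarrow> (nat \<Rightarrow> real) measure \<Rightarrow> (nat \<times> nat \<Rightarrow> real)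
     \<Rightarrow> (nat \<Rightarrow> real) \<Rightarrow> ((nat \<Rightarrow> real) \<times> (nat \<Rightarrow> real)) measure" where
  "sampling_law m n \<sigma> R P A \<xi> =
     R \<bind> (\<lambda>x. posterior m n \<sigma> P (measurement m n A \<xi> x) A
                  \<bind> (\<lambda>xhat. return (Rn n \<Otimes>\<^sub>M Rn n) (x, xhat)))"

(* \<epsilon> / \<delta>^(1/p), read as \<infinity> for \<delta> = 0 *)
definition noise_threshold :: "real \<Rightarrow> real \<Rightarrow> real \<Rightarrow> ereal" where
  "noise_threshold \<epsilon> \<delta> p = (if \<delta> = 0 then \<infinity> else ereal (\<epsilon> / \<delta> powr (1 / p)))"

end

theory Submission
  imports Defs
begin

text \<open>Couple \<open>x* = u ~ R\<close> with \<open>v ~ P\<close> so that \<open>|u - v| \<le> \<sigma>\<close> outside an event of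
  probability \<open>\<delta>\<close>, and put \<open>\<rho> = \<eta> + \<sigma>\<close>. Fix a centre \<open>x0\<close> of the covering with \<open>|u - x0| \<le> \<rho>\<close>.
  Except with probability \<open>3 exp(-m/2)\<close>, the noise has norm at most \<open>2\<sigma>\<close> and \<open>A\<close> at most doubles the
  bounds on \<open>|u - v|\<close> and \<open>|u - x0|\<close>. Then the observation \<open>y\<close> lies within \<open>4\<rho>\<close> of \<open>A x0\<close>, and
  its likelihood under \<open>u\<close> is at most \<open>exp(8m)\<close> times that under \<open>v\<close>. Averaged over the coupling,
  the likelihood under \<open>v\<close> is at most the normalizing constant of the posterior, which cancels: the
  expected posterior mass of the points far from \<open>x0\<close> is at most \<open>exp(8m)\<close> times the probability
  that a far point is observed within \<open>4\<rho>\<close> of \<open>A x0\<close>. By the lower tail of \<open>|A w|\<close> this probability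
  is at most \<open>2 exp(-17m/2)\<close> if far means at distance at least \<open>10 exp(9) \<rho>\<close>.

  Summing over at most \<open>exp(m/4)\<close> centres leaves \<open>5 exp(-m/4)\<close>, to which Markov's inequality over
  \<open>(A, \<xi>)\<close> is applied. The two events of probability \<open>\<delta>\<close> (distant coupling, uncovered point)
  do not involve \<open>(A, \<xi>)\<close>, so they contribute \<open>2\<delta>\<close> for every \<open>(A, \<xi>)\<close> and Markov's inequality is not
  spent on them. Small \<open>m\<close> is trivial because then \<open>2 exp(-c0 m) \<ge> 1\<close>.\<close>

section \<open>Gaussian matrices and Gaussian noise\<close>

text \<open>With \<open>q = 1 - 2 * t * v\<^sup>2\<close>, the factor
  \<open>exp (t * x\<^sup>2)\<close> turns the normal density of variance \<open>v\<^sup>2\<close>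
  into \<open>1 / sqrt q\<close> times the one of variance \<open>v\<^sup>2 / q\<close>, which
  integrates to 1. Negative \<open>t\<close> is allowed and later yields the lower tail.\<close>

lemma nn_integral_normal_density_exp_square:
  assumes v: "0 < v" and t: "2 * t * v\<^sup>2 < 1"
  shows "(\<integral>\<^sup>+x. ennreal (exp (t * x\<^sup>2)) \<partial>density lborel (normal_density 0 v))
    = ennreal (1 / sqrt (1 - 2 * t * v\<^sup>2))"
proof -
  define q where "q = 1 - 2 * t * v\<^sup>2"
  define w where "w = v / sqrt q"
  have q: "0 < q" using t by (simp add: q_def)
  have w: "0 < w" using v q by (simp add: w_def)
  have w2: "w\<^sup>2 = v\<^sup>2 / q" using q by (simp add: w_def power_divide)
  have eq: "normal_density 0 v x * exp (t * x\<^sup>2) = 1 / sqrt q * normal_density 0 w x" for x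
  proof -
    have e: "- x\<^sup>2 / (2 * v\<^sup>2) + t * x\<^sup>2 = - x\<^sup>2 / (2 * w\<^sup>2)"
      using v q by (simp add: w2 field_simps) (simp add: q_def algebra_simps)
    have "exp (- x\<^sup>2 / (2 * v\<^sup>2)) * exp (t * x\<^sup>2) = exp (- x\<^sup>2 / (2 * w\<^sup>2))"
      unfolding e[symmetric] exp_add ..
    moreover have "1 / sqrt (2 * pi * v\<^sup>2) = 1 / sqrt q * (1 / sqrt (2 * pi * w\<^sup>2))"
      using v q by (simp add: w2 real_sqrt_divide real_sqrt_mult)
    ultimately show ?thesis
      by (simp add: normal_density_def)
  qed
  have "(\<integral>\<^sup>+x. ennreal (exp (t * x\<^sup>2)) \<partial>density lborel (normal_density 0 v))
      = (\<integral>\<^sup>+x. ennreal (normal_density 0 v x * exp (t * x\<^sup>2)) \<partial>lborel)"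
    by (subst nn_integral_density) (auto simp: ennreal_mult)
  also have "\<dots> = (\<integral>\<^sup>+x. ennreal (1 / sqrt q) * ennreal (normal_density 0 w x) \<partial>lborel)"
    unfolding eq using q by (subst ennreal_mult) auto
  also have "\<dots> = ennreal (1 / sqrt q) * (\<integral>\<^sup>+x. ennreal (normal_density 0 w x) \<partial>lborel)"
    by (rule nn_integral_cmult) auto
  also have "(\<integral>\<^sup>+x. ennreal (normal_density 0 w x) \<partial>lborel) = 1"
    using prob_space.emeasure_space_1[OF prob_space_normal_density[OF w, of 0]]
    by (simp add: emeasure_density)
  finally show ?thesis by (simp add: q_def)
qed

text \<open>The joint law of all coordinates is the product measure itself and its marginals are the
  factors, so the criterion "joint law equals product of the marginals" applies.\<close>

lemma indep_vars_PiM_coordinates: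
  assumes "\<And>i. i \<in> I \<Longrightarrow> prob_space (M i)" and "finite I" "I \<noteq> {}"
  shows "prob_space.indep_vars (PiM I M) M (\<lambda>i x. x i) I"
proof -
  interpret P: prob_space "PiM I M" by (intro prob_space_PiM assms)
  have "distr (PiM I M) (PiM I M) (\<lambda>x. \<lambda>i\<in>I. x i) = distr (PiM I M) (PiM I M) (\<lambda>x. x)"
    by (intro distr_cong refl) (auto simp: space_PiM PiE_def extensional_restrict)
  also have "\<dots> = PiM I M" by (rule distr_id)
  also have "\<dots> = (\<Pi>\<^sub>M i\<in>I. distr (PiM I M) (M i) (\<lambda>x. x i))"
    using assms(1) by (intro PiM_cong refl) (simp add: distr_PiM_component)
  finally show ?thesis
    using assms by (subst P.indep_vars_iff_distr_eq_PiM') auto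
qed

text \<open>A linear combination of independent centred normal variables is centred normal, with the
  variances added; this reduces the claim to one dimension.\<close>

lemma nn_integral_exp_square_normal_combination:
  fixes w :: "'a \<Rightarrow> real"
  assumes J: "finite J" and s: "0 < s" and t: "2 * t * (s\<^sup>2 * (\<Sum>j\<in>J. (w j)\<^sup>2)) < 1"
  shows "(\<integral>\<^sup>+x. ennreal (exp (t * (\<Sum>j\<in>J. x j * w j)\<^sup>2)) \<partial>PiM J (\<lambda>_. density lborel (normal_density 0 s)))
    = ennreal (1 / sqrt (1 - 2 * t * (s\<^sup>2 * (\<Sum>j\<in>J. (w j)\<^sup>2))))"
proof -
  \<comment> \<open>Terms with coefficient 0 are removed, since their law is a point mass and has no
    normal density. If nothing remains, both sides are 1.\<close>
  define J' where "J' = {j \<in> J. w j \<noteq> 0}"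
  define M where "M = (\<lambda>_::'a. density lborel (normal_density 0 s))"
  have prob: "prob_space (M i)" for i using s by (simp add: M_def prob_space_normal_density)
  interpret P: prob_space "PiM J M" by (intro prob_space_PiM prob)
  have sum1: "(\<Sum>j\<in>J. x j * w j) = (\<Sum>j\<in>J'. x j * w j)" for x :: "'a \<Rightarrow> real"
    using J by (intro sum.mono_neutral_right) (auto simp: J'_def)
  have sum2: "(\<Sum>j\<in>J. (w j)\<^sup>2) = (\<Sum>j\<in>J'. (w j)\<^sup>2)"
    using J by (intro sum.mono_neutral_right) (auto simp: J'_def)
  show ?thesis
  proof (cases "J' = {}")
    case True
    then show ?thesis using P.emeasure_space_1 by (simp add: sum1 sum2 M_def)
  next
    case False
    then have "J \<noteq> {}" by (auto simp: J'_def)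
    have sub: "J' \<subseteq> J" by (auto simp: J'_def)
    have "P.indep_vars M (\<lambda>j x. x j) J'"
      using indep_vars_PiM_coordinates[of J M] prob J \<open>J \<noteq> {}\<close> sub P.indep_vars_subset by blast
    then have ind: "P.indep_vars (\<lambda>_. borel) (\<lambda>j x. x j * w j) J'"
      by (rule P.indep_vars_compose2) (simp add: M_def)
    have d: "distributed (PiM J M) lborel (\<lambda>x. x j * w j) (normal_density 0 (s * \<bar>w j\<bar>))" if "j \<in> J'" for j
    proof -
      have j: "j \<in> J" "w j \<noteq> 0" using that by (auto simp: J'_def)
      have dd: "distr (PiM J M) lborel (\<lambda>x. x j) = M j"
      proof -
        have "distr (PiM J M) lborel (\<lambda>x. x j) = distr (PiM J M) (M j) (\<lambda>x. x j)"
          by (intro distr_cong) (auto simp: M_def)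
        also have "\<dots> = M j" using prob j by (intro distr_PiM_component)
        finally show ?thesis .
      qed
      have 0: "distributed (PiM J M) lborel (\<lambda>x. x j) (normal_density 0 s)"
        unfolding distributed_def using dd j by (auto simp: M_def)
      have "distributed (PiM J M) lborel (\<lambda>x. 0 + w j * x j) (normal_density (0 + w j * 0) (\<bar>w j\<bar> * s))"
        by (rule P.normal_density_affine[OF 0 s j(2)])
      then show ?thesis by (simp add: mult.commute)
    qed
    define v where "v = sqrt (\<Sum>j\<in>J'. (s * \<bar>w j\<bar>)\<^sup>2)"
    have v2: "v\<^sup>2 = s\<^sup>2 * (\<Sum>j\<in>J'. (w j)\<^sup>2)"
      by (simp add: v_def sum_nonneg power_mult_distrib sum_distrib_left)
    have "0 < (\<Sum>j\<in>J'. (s * \<bar>w j\<bar>)\<^sup>2)"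
      using False J s by (intro sum_pos) (auto simp: J'_def)
    then have v: "0 < v" by (simp add: v_def)
    have "distributed (PiM J M) lborel (\<lambda>x. \<Sum>j\<in>J'. x j * w j) (normal_density (\<Sum>j\<in>J'. 0) v)"
      unfolding v_def using J False ind d s by (intro P.sum_indep_normal) (auto simp: J'_def)
    note dist = this
    then have D: "distr (PiM J M) lborel (\<lambda>x. \<Sum>j\<in>J'. x j * w j) = density lborel (normal_density 0 v)"
      by (simp add: distributed_def)
    have [measurable]: "(\<lambda>x. \<Sum>j\<in>J'. x j * w j) \<in> borel_measurable (PiM J M)"
      using distributed_measurable[OF dist] by simp
    have "(\<integral>\<^sup>+x. ennreal (exp (t * (\<Sum>j\<in>J'. x j * w j)\<^sup>2)) \<partial>PiM J M)
       = (\<integral>\<^sup>+z. ennreal (exp (t * z\<^sup>2)) \<partial>distr (PiM J M) lborel (\<lambda>x. \<Sum>j\<in>J'. x j * w j))"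
      by (subst nn_integral_distr) auto
    also have "\<dots> = ennreal (1 / sqrt (1 - 2 * t * v\<^sup>2))"
      unfolding D using t v by (intro nn_integral_normal_density_exp_square) (auto simp: v2 sum2)
    finally show ?thesis by (simp add: sum1 sum2 v2 M_def)
  qed
qed

text \<open>The rows of \<open>A\<close> are independent and each entry of \<open>A w\<close> is
  normal with variance \<open>|w|^2 / m\<close>, so the exponential of the sum of squares integrates
  to a product of \<open>m\<close> equal one-dimensional moments.\<close>

lemma nn_integral_exp_square_matvec:
  assumes m: "1 \<le> m" and t: "2 * t * (\<Sum>j<n. (w j)\<^sup>2) < real m"
  shows "(\<integral>\<^sup>+A. ennreal (exp (t * (L2_set (matvec m n A w) {..<m})\<^sup>2)) \<partial>gaussian_matrix m n)
    = ennreal ((1 / sqrt (1 - 2 * t * (\<Sum>j<n. (w j)\<^sup>2) / real m)) ^ m)"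
proof -
  define s where "s = sqrt (1 / real m)"
  have s: "0 < s" "s\<^sup>2 = 1 / real m" using m by (auto simp: s_def)
  define M where "M = (\<lambda>_::nat \<times> nat. density lborel (normal_density 0 s))"
  define I where "I = {..<m} \<times> {..<n}"
  have G: "gaussian_matrix m n = PiM I M" by (simp add: gaussian_matrix_def M_def I_def s_def)
  have prob: "prob_space (M i)" for i using s by (simp add: M_def prob_space_normal_density)
  interpret P: prob_space "PiM I M" by (intro prob_space_PiM prob)
  define f where "f i A = (\<Sum>j<n. A (i, j) * w j)" for i and A :: "nat \<times> nat \<Rightarrow> real"
  have norm: "(L2_set (matvec m n A w) {..<m})\<^sup>2 = (\<Sum>i<m. (f i A)\<^sup>2)" for A
    by (simp add: L2_set_def matvec_def f_def sum_nonneg)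
  have row: "(\<integral>\<^sup>+A. ennreal (exp (t * (f i A)\<^sup>2)) \<partial>PiM I M)
     = ennreal (1 / sqrt (1 - 2 * t * (\<Sum>j<n. (w j)\<^sup>2) / real m))" if i: "i < m" for i
  proof -
    \<comment> \<open>Extending \<open>w\<close> by 0 outside row \<open>i\<close> makes entry
      \<open>i\<close> of \<open>A w\<close> a linear combination of all entries of the matrix, as
      the one-dimensional reduction expects.\<close>
    define w' where "w' q = (if fst q = i then w (snd q) else 0)" for q :: "nat \<times> nat"
    have reindex: "(\<Sum>q\<in>I. if fst q = i then h q else 0) = (\<Sum>j<n. h (i, j))" for h :: "nat \<times> nat \<Rightarrow> real"
    proof -
      have "(\<Sum>q\<in>I. if fst q = i then h q else 0) = (\<Sum>a<m. \<Sum>j<n. if a = i then h (a, j) else 0)"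
        unfolding I_def sum.cartesian_product by (intro sum.cong) auto
      also have "\<dots> = (\<Sum>a<m. if a = i then \<Sum>j<n. h (a, j) else 0)" by (intro sum.cong) auto
      also have "\<dots> = (\<Sum>j<n. h (i, j))" using i by simp
      finally show ?thesis .
    qed
    have f: "f i A = (\<Sum>q\<in>I. A q * w' q)" for A
      using reindex[of "\<lambda>q. A q * w (snd q)"] by (simp add: f_def w'_def if_distrib cong: if_cong)
    have w2: "(\<Sum>q\<in>I. (w' q)\<^sup>2) = (\<Sum>j<n. (w j)\<^sup>2)"
      using reindex[of "\<lambda>q. (w (snd q))\<^sup>2"] by (simp add: w'_def if_distrib[of "\<lambda>x. x\<^sup>2"] cong: if_cong)
    have t': "2 * t * (s\<^sup>2 * (\<Sum>q\<in>I. (w' q)\<^sup>2)) = 2 * t * (\<Sum>j<n. (w j)\<^sup>2) / real m"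
      by (simp add: w2 s)
    moreover have "\<dots> < 1" using t m by simp
    ultimately show ?thesis
      unfolding f M_def using s by (subst nn_integral_exp_square_normal_combination) (auto simp: I_def)
  qed
  show ?thesis
  \<comment> \<open>For \<open>n = 0\<close> there are no matrix entries to be independent; then
    \<open>A w = 0\<close> and both sides are 1.\<close>
  proof (cases "n = 0")
    case True
    have "f i A = 0" for i A using True by (simp add: f_def)
    then have "L2_set (matvec m n A w) {..<m} = 0" for A
      using norm[of A] by simp
    then show ?thesis using P.emeasure_space_1 unfolding G[symmetric] by (simp add: True)
  next
    case False
    have "I \<noteq> {}" "finite I" using m False by (auto simp: I_def lessThan_empty_iff)
    then have "P.indep_vars M (\<lambda>q A. A q) I" using prob by (intro indep_vars_PiM_coordinates)
    \<comment> \<open>Independent entries, grouped into the disjoint rows, give independent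
      rows.\<close>
    then have "P.indep_vars (\<lambda>i. PiM ({i} \<times> {..<n}) M) (\<lambda>i A. restrict (\<lambda>q. A q) ({i} \<times> {..<n})) {..<m}"
      by (rule P.indep_vars_restrict) (auto simp: I_def disjoint_family_on_def)
    then have "P.indep_vars (\<lambda>_. borel)
        (\<lambda>i A. (\<lambda>r. ennreal (exp (t * (f i r)\<^sup>2))) (restrict (\<lambda>q. A q) ({i} \<times> {..<n}))) {..<m}"
      by (rule P.indep_vars_compose2) (simp add: f_def M_def)
    then have ind: "P.indep_vars (\<lambda>_. borel) (\<lambda>i A. ennreal (exp (t * (f i A)\<^sup>2))) {..<m}"
      by (simp add: f_def)
    have "ennreal (exp (t * (\<Sum>i<m. (f i A)\<^sup>2))) = (\<Prod>i<m. ennreal (exp (t * (f i A)\<^sup>2)))" for A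
      by (simp add: prod_ennreal exp_sum[symmetric] sum_distrib_left)
    then have "(\<integral>\<^sup>+A. ennreal (exp (t * (L2_set (matvec m n A w) {..<m})\<^sup>2)) \<partial>gaussian_matrix m n)
        = (\<integral>\<^sup>+A. (\<Prod>i<m. ennreal (exp (t * (f i A)\<^sup>2))) \<partial>PiM I M)"
      by (simp only: G norm)
    also have "\<dots> = (\<Prod>i<m. \<integral>\<^sup>+A. ennreal (exp (t * (f i A)\<^sup>2)) \<partial>PiM I M)"
      by (rule P.indep_vars_nn_integral[OF _ ind]) auto
    also have "\<dots> = (\<Prod>i<m. ennreal (1 / sqrt (1 - 2 * t * (\<Sum>j<n. (w j)\<^sup>2) / real m)))"
      using row by (intro prod.cong) auto
    finally show ?thesis
      using t m by (simp add: ennreal_power)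
  qed
qed

lemma nn_integral_exp_square_gaussian_noise:
  assumes m: "1 \<le> m" and \<sigma>: "0 < \<sigma>" and t: "2 * t * \<sigma>\<^sup>2 < real m"
  shows "(\<integral>\<^sup>+\<xi>. ennreal (exp (t * (L2_set \<xi> {..<m})\<^sup>2)) \<partial>gaussian_noise m \<sigma>)
    = ennreal ((1 / sqrt (1 - 2 * t * \<sigma>\<^sup>2 / real m)) ^ m)"
proof -
  define s where "s = sqrt (\<sigma>\<^sup>2 / real m)"
  have s: "0 < s" "s\<^sup>2 = \<sigma>\<^sup>2 / real m" using m \<sigma> by (auto simp: s_def)
  define M where "M = (\<lambda>_::nat. density lborel (normal_density 0 s))"
  have N: "gaussian_noise m \<sigma> = PiM {..<m} M" by (simp add: gaussian_noise_def M_def s_def)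
  have prob: "prob_space (M i)" for i using s by (simp add: M_def prob_space_normal_density)
  interpret product_sigma_finite M
    using prob by (intro product_sigma_finite.intro prob_space_imp_sigma_finite)
  have "ennreal (exp (t * (L2_set \<xi> {..<m})\<^sup>2)) = (\<Prod>i<m. ennreal (exp (t * (\<xi> i)\<^sup>2)))" for \<xi>
    by (simp add: L2_set_def sum_nonneg prod_ennreal exp_sum[symmetric] sum_distrib_left)
  then have "(\<integral>\<^sup>+\<xi>. ennreal (exp (t * (L2_set \<xi> {..<m})\<^sup>2)) \<partial>gaussian_noise m \<sigma>)
      = (\<integral>\<^sup>+\<xi>. (\<Prod>i<m. ennreal (exp (t * (\<xi> i)\<^sup>2))) \<partial>PiM {..<m} M)"
    by (simp only: N)
  also have "\<dots> = (\<Prod>i<m. \<integral>\<^sup>+x. ennreal (exp (t * x\<^sup>2)) \<partial>M i)"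
    by (rule product_nn_integral_prod) (auto simp: M_def)
  also have "\<dots> = (\<Prod>i<m. ennreal (1 / sqrt (1 - 2 * t * \<sigma>\<^sup>2 / real m)))"
  proof (intro prod.cong refl)
    have "2 * t * s\<^sup>2 = 2 * t * \<sigma>\<^sup>2 / real m" by (simp add: s)
    moreover have "\<dots> < 1" using t m by simp
    ultimately show "(\<integral>\<^sup>+x. ennreal (exp (t * x\<^sup>2)) \<partial>M i) = ennreal (1 / sqrt (1 - 2 * t * \<sigma>\<^sup>2 / real m))" for i
      unfolding M_def using s by (subst nn_integral_normal_density_exp_square) auto
  qed
  finally show ?thesis
    using t m by (simp add: ennreal_power)
qed

section \<open>Chernoff bounds for the noise and for matrix images\<close>

text \<open>Applied with \<open>g\<close> a positive multiple of a squared norm for upper tails and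
  a negative multiple for the lower tail.\<close>

lemma exp_Markov_inequality:
  fixes g :: "'a \<Rightarrow> real"
  assumes [measurable]: "g \<in> borel_measurable M"
  shows "emeasure M {x \<in> space M. b \<le> g x} \<le> ennreal (exp (- b)) * (\<integral>\<^sup>+x. ennreal (exp (g x)) \<partial>M)"
proof -
  have "emeasure M {x \<in> space M. b \<le> g x} = (\<integral>\<^sup>+x. indicator {x \<in> space M. b \<le> g x} x \<partial>M)"
    by simp
  also have "\<dots> \<le> (\<integral>\<^sup>+x. ennreal (exp (- b)) * ennreal (exp (g x)) \<partial>M)"
    by (intro nn_integral_mono)
      (auto simp: indicator_def ennreal_mult'[symmetric] exp_add[symmetric] ennreal_1[symmetric] simp del: ennreal_1)
  also have "\<dots> = ennreal (exp (- b)) * (\<integral>\<^sup>+x. ennreal (exp (g x)) \<partial>M)"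
    by (rule nn_integral_cmult) auto
  finally show ?thesis .
qed

text \<open>Here \<open>1 - x\<close> is at least 1/2 and hence at least \<open>exp (-1)\<close>.
  This bounds each of the \<open>m\<close> factors of an exponential moment whose parameter is small
  enough that \<open>x \<le> 1 / 2\<close>.\<close>

lemma chi_square_factor_le:
  assumes "x \<le> 1 / 2"
  shows "1 / sqrt (1 - x) \<le> exp (1 / 2)"
proof -
  have "exp (- (1 / 2)) ^ 2 \<le> 1 - x"
  proof -
    have "(2::real) \<le> exp 1" using exp_ge_add_one_self[of 1] by simp
    then have "exp (- 1) \<le> (1 / 2 :: real)" by (simp add: exp_minus field_simps)
    then show ?thesis using assms by (simp add: power2_eq_square exp_add[symmetric])
  qed
  then have "exp (- (1 / 2)) \<le> sqrt (1 - x)" by (simp add: real_le_rsqrt)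
  then have "1 / sqrt (1 - x) \<le> 1 / exp (- (1 / 2))"
    using assms by (intro divide_left_mono) (auto intro!: mult_pos_pos)
  then show ?thesis by (simp add: exp_minus field_simps)
qed

text \<open>Densities over \<open>lborel\<close> keep the Borel sets. As
  \<open>measurable_cong\<close> rules, this and the next two facts let later measurability goals be
  stated over plain products of \<open>borel\<close>.\<close>

lemma sets_gaussian_matrix [measurable_cong]:
  "sets (gaussian_matrix m n) = sets (PiM ({..<m} \<times> {..<n}) (\<lambda>_. borel))"
  unfolding gaussian_matrix_def by (intro sets_PiM_cong) auto

lemma sets_gaussian_noise [measurable_cong]: "sets (gaussian_noise m \<sigma>) = sets (PiM {..<m} (\<lambda>_. borel))"
  unfolding gaussian_noise_def by (intro sets_PiM_cong) auto

lemma sets_Rn [measurable_cong]: "sets (Rn n) = sets (PiM {..<n} (\<lambda>_. borel))"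
  by (simp add: Rn_def)

lemma measurable_matvec [measurable (raw)]:
  assumes [measurable]: "f \<in> M \<rightarrow>\<^sub>M PiM ({..<m} \<times> {..<n}) (\<lambda>_. borel)" "g \<in> M \<rightarrow>\<^sub>M PiM {..<n} (\<lambda>_. borel)"
  shows "(\<lambda>x. matvec m n (f x) (g x)) \<in> M \<rightarrow>\<^sub>M PiM {..<m} (\<lambda>_. borel)"
  unfolding matvec_def by measurable

lemma measurable_L2_set [measurable (raw)]:
  assumes [measurable]: "f \<in> M \<rightarrow>\<^sub>M PiM {..<m} (\<lambda>_. borel)"
  shows "(\<lambda>x. L2_set (f x) {..<m}) \<in> borel_measurable M"
  unfolding L2_set_def by measurable

text \<open>Chernoff bound with \<open>t = m / (4 r^2)\<close>: then \<open>2 t |w|^2 / m\<close> is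
  at most 1/2, the moment is at most \<open>exp (m / 2)\<close>, and the threshold contributes
  \<open>exp (- m K^2 / 4)\<close>. The values used later are \<open>K = 2\<close> (matrix and
  noise) and \<open>K = 6\<close> (noise only).\<close>

lemma emeasure_gaussian_matrix_large:
  assumes m: "1 \<le> m" and r: "0 < r" and K: "0 \<le> K" and w: "L2_set w {..<n} \<le> r" "w \<in> space (Rn n)"
  shows "emeasure (gaussian_matrix m n) {A \<in> space (gaussian_matrix m n). K * r < L2_set (matvec m n A w) {..<m}}
    \<le> ennreal (exp (real m * (1 / 2 - K\<^sup>2 / 4)))"
proof -
  define t where "t = real m / (4 * r\<^sup>2)"
  have t: "0 < t" using m r by (simp add: t_def)
  have w2: "(\<Sum>j<n. (w j)\<^sup>2) \<le> r\<^sup>2"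
    using w(1) by (simp add: L2_set_def sqrt_le_D)
  have [measurable]: "w \<in> space (PiM {..<n} (\<lambda>_. borel))" using w(2) by (simp add: Rn_def)
  have x: "2 * t * (\<Sum>j<n. (w j)\<^sup>2) / real m \<le> 1 / 2"
    using w2 m r by (simp add: t_def field_simps)
  then have "2 * t * (\<Sum>j<n. (w j)\<^sup>2) < real m" using m by (simp add: field_simps)
  note I = nn_integral_exp_square_matvec[OF m this]
  have "emeasure (gaussian_matrix m n) {A \<in> space (gaussian_matrix m n). K * r < L2_set (matvec m n A w) {..<m}}
      \<le> emeasure (gaussian_matrix m n)
        {A \<in> space (gaussian_matrix m n). t * (K * r)\<^sup>2 \<le> t * (L2_set (matvec m n A w) {..<m})\<^sup>2}"
    using t K r w by (intro emeasure_mono) (auto intro!: power_mono mult_left_mono)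
  also have "\<dots> \<le> ennreal (exp (- (t * (K * r)\<^sup>2))) * ennreal ((1 / sqrt (1 - 2 * t * (\<Sum>j<n. (w j)\<^sup>2) / real m)) ^ m)"
    unfolding I[symmetric] by (rule exp_Markov_inequality) auto
  also have "\<dots> \<le> ennreal (exp (- (t * (K * r)\<^sup>2))) * ennreal (exp (1 / 2) ^ m)"
    using chi_square_factor_le[OF x] x by (intro mult_left_mono ennreal_leI power_mono) auto
  also have "\<dots> = ennreal (exp (real m * (1 / 2 - K\<^sup>2 / 4)))"
    using r by (simp add: t_def ennreal_mult'[symmetric] exp_of_nat_mult[symmetric] exp_add[symmetric]
        power_mult_distrib algebra_simps)
  finally show ?thesis .
qed

lemma emeasure_gaussian_noise_large:
  assumes m: "1 \<le> m" and \<sigma>: "0 < \<sigma>" and K: "0 \<le> K"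
  shows "emeasure (gaussian_noise m \<sigma>) {\<xi> \<in> space (gaussian_noise m \<sigma>). K * \<sigma> < L2_set \<xi> {..<m}}
    \<le> ennreal (exp (real m * (1 / 2 - K\<^sup>2 / 4)))"
proof -
  define t where "t = real m / (4 * \<sigma>\<^sup>2)"
  have t: "0 < t" using m \<sigma> by (simp add: t_def)
  have x: "2 * t * \<sigma>\<^sup>2 / real m \<le> 1 / 2"
    using m \<sigma> by (simp add: t_def field_simps)
  then have "2 * t * \<sigma>\<^sup>2 < real m" using m by (simp add: field_simps)
  note I = nn_integral_exp_square_gaussian_noise[OF m \<sigma> this]
  have "emeasure (gaussian_noise m \<sigma>) {\<xi> \<in> space (gaussian_noise m \<sigma>). K * \<sigma> < L2_set \<xi> {..<m}}
      \<le> emeasure (gaussian_noise m \<sigma>)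
        {\<xi> \<in> space (gaussian_noise m \<sigma>). t * (K * \<sigma>)\<^sup>2 \<le> t * (L2_set \<xi> {..<m})\<^sup>2}"
    using t K \<sigma> by (intro emeasure_mono) (auto intro!: power_mono mult_left_mono)
  also have "\<dots> \<le> ennreal (exp (- (t * (K * \<sigma>)\<^sup>2))) * ennreal ((1 / sqrt (1 - 2 * t * \<sigma>\<^sup>2 / real m)) ^ m)"
    unfolding I[symmetric] by (rule exp_Markov_inequality) auto
  also have "\<dots> \<le> ennreal (exp (- (t * (K * \<sigma>)\<^sup>2))) * ennreal (exp (1 / 2) ^ m)"
    using chi_square_factor_le[OF x] x by (intro mult_left_mono ennreal_leI power_mono) auto
  also have "\<dots> = ennreal (exp (real m * (1 / 2 - K\<^sup>2 / 4)))"
    using \<sigma> by (simp add: t_def ennreal_mult'[symmetric] exp_of_nat_mult[symmetric] exp_add[symmetric]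
        power_mult_distrib algebra_simps)
  finally show ?thesis .
qed

text \<open>Chernoff bound with the negative parameter \<open>- t\<close>, where
  \<open>t = m / (2 (s d)^2)\<close>: the threshold costs \<open>exp (m / 2)\<close>, while each row
  factor is \<open>1 / sqrt q\<close> with \<open>q\<close> at least \<open>1 / s^2\<close>, hence
  at most \<open>s\<close>. The rate can therefore be made as large as desired by taking
  \<open>s\<close> small, which is what later outweighs \<open>exp (8 m)\<close>.\<close>

lemma emeasure_gaussian_matrix_small:
  assumes m: "1 \<le> m" and d: "0 < d" and s: "0 < s" and w: "d \<le> L2_set w {..<n}" "w \<in> space (Rn n)"
  shows "emeasure (gaussian_matrix m n) {A \<in> space (gaussian_matrix m n). L2_set (matvec m n A w) {..<m} \<le> s * d}
    \<le> ennreal ((exp (1 / 2) * s) ^ m)"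
proof -
  define t where "t = real m / (2 * (s * d)\<^sup>2)"
  have t: "0 < t" using m s d by (simp add: t_def)
  have w2: "d\<^sup>2 \<le> (\<Sum>j<n. (w j)\<^sup>2)"
    using power_mono[OF w(1), of 2] d by (simp add: L2_set_def sum_nonneg)
  have [measurable]: "w \<in> space (PiM {..<n} (\<lambda>_. borel))" using w(2) by (simp add: Rn_def)
  define q where "q = 1 - 2 * (- t) * (\<Sum>j<n. (w j)\<^sup>2) / real m"
  have "1 / s\<^sup>2 = d\<^sup>2 / (s * d)\<^sup>2" using d by (simp add: power_mult_distrib)
  also have "\<dots> \<le> (\<Sum>j<n. (w j)\<^sup>2) / (s * d)\<^sup>2" by (rule divide_right_mono[OF w2]) simp
  also have "\<dots> \<le> q" using m by (simp add: q_def t_def)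
  finally have "sqrt (1 / s\<^sup>2) \<le> sqrt q" by simp
  then have q: "1 / s \<le> sqrt q" using s by (simp add: real_sqrt_divide)
  have q0: "0 < sqrt q" by (rule order_less_le_trans[OF _ q]) (use s in simp)
  from q have q': "1 / sqrt q \<le> s"
    using s q0 by (simp add: field_simps)
  have "2 * (- t) * (\<Sum>j<n. (w j)\<^sup>2) \<le> 0" using t by (simp add: sum_nonneg)
  then have "2 * (- t) * (\<Sum>j<n. (w j)\<^sup>2) < real m" using m by linarith
  note I = nn_integral_exp_square_matvec[OF m this]
  have "emeasure (gaussian_matrix m n) {A \<in> space (gaussian_matrix m n). L2_set (matvec m n A w) {..<m} \<le> s * d}
      \<le> emeasure (gaussian_matrix m n)
        {A \<in> space (gaussian_matrix m n). - t * (s * d)\<^sup>2 \<le> - t * (L2_set (matvec m n A w) {..<m})\<^sup>2}"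
    using t s d by (intro emeasure_mono) (auto intro!: power_mono mult_left_mono)
  also have "\<dots> \<le> ennreal (exp (- (- t * (s * d)\<^sup>2))) * ennreal ((1 / sqrt q) ^ m)"
    unfolding I[folded q_def, symmetric] by (intro exp_Markov_inequality) auto
  also have "\<dots> \<le> ennreal (exp (real m * (1 / 2))) * ennreal (s ^ m)"
    using q' q0 s d by (intro mult_mono ennreal_leI power_mono) (auto simp: t_def)
  also have "\<dots> = ennreal ((exp (1 / 2) * s) ^ m)"
    using s by (simp only: ennreal_mult exp_of_nat_mult power_mult_distrib zero_le_power exp_ge_zero less_imp_le)
  finally show ?thesis .
qed

section \<open>Distances, measurements and likelihoods\<close>

lemma l2_dist_nonneg [simp]: "0 \<le> l2_dist n u v"
  by (simp add: l2_dist_def)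

lemma l2_dist_commute: "l2_dist n u v = l2_dist n v u"
  by (simp add: l2_dist_def L2_set_def power2_commute)

lemma l2_dist_triangle: "l2_dist n u w \<le> l2_dist n u v + l2_dist n v w"
  using L2_set_triangle_ineq[of "\<lambda>i. u i - v i" "\<lambda>i. v i - w i" "{..<n}"]
  by (simp add: l2_dist_def)

lemma l2_dist_measurement: "l2_dist m (measurement m n A \<xi> x) (matvec m n A x) = L2_set \<xi> {..<m}"
  by (simp add: l2_dist_def measurement_def L2_set_def)

text \<open>Linearity of \<open>A\<close> turns bounds on the norm of \<open>A w\<close> into bounds
  on distances between images. The difference vector is restricted to \<open>{..<n}\<close> so that
  it is a point of \<open>Rn n\<close>.\<close>

lemma L2_set_matvec_diff:
  "L2_set (matvec m n A (\<lambda>j\<in>{..<n}. u j - v j)) {..<m} = l2_dist m (matvec m n A u) (matvec m n A v)"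
  by (simp add: l2_dist_def matvec_def L2_set_def algebra_simps sum_subtractf)

lemma emeasure_gaussian_matrix_expands:
  assumes "1 \<le> m" "0 < r" "0 \<le> K" "l2_dist n u v \<le> r" "u \<in> space (Rn n)" "v \<in> space (Rn n)"
  shows "emeasure (gaussian_matrix m n)
      {A \<in> space (gaussian_matrix m n). K * r < l2_dist m (matvec m n A u) (matvec m n A v)}
    \<le> ennreal (exp (real m * (1 / 2 - K\<^sup>2 / 4)))"
proof -
  have "(\<lambda>j\<in>{..<n}. u j - v j) \<in> space (Rn n)" by (simp add: Rn_def space_PiM)
  moreover have "L2_set (\<lambda>j\<in>{..<n}. u j - v j) {..<n} \<le> r"
    using assms by (simp add: l2_dist_def L2_set_def)
  ultimately show ?thesis
    using emeasure_gaussian_matrix_large[OF assms(1-3), of "\<lambda>j\<in>{..<n}. u j - v j" n]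
    by (simp only: L2_set_matvec_diff)
qed

lemma emeasure_gaussian_matrix_contracts:
  assumes "1 \<le> m" "0 < d" "0 < s" "d \<le> l2_dist n u v" "u \<in> space (Rn n)" "v \<in> space (Rn n)"
  shows "emeasure (gaussian_matrix m n)
      {A \<in> space (gaussian_matrix m n). l2_dist m (matvec m n A u) (matvec m n A v) \<le> s * d}
    \<le> ennreal ((exp (1 / 2) * s) ^ m)"
proof -
  have "(\<lambda>j\<in>{..<n}. u j - v j) \<in> space (Rn n)" by (simp add: Rn_def space_PiM)
  moreover have "d \<le> L2_set (\<lambda>j\<in>{..<n}. u j - v j) {..<n}"
    using assms by (simp add: l2_dist_def L2_set_def)
  ultimately show ?thesis
    using emeasure_gaussian_matrix_small[OF assms(1-3), of "\<lambda>j\<in>{..<n}. u j - v j" n]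
    by (simp only: L2_set_matvec_diff)
qed

lemma measurable_l2_dist [measurable (raw)]:
  assumes [measurable]: "f \<in> M \<rightarrow>\<^sub>M PiM {..<n} (\<lambda>_. borel)" "g \<in> M \<rightarrow>\<^sub>M PiM {..<n} (\<lambda>_. borel)"
  shows "(\<lambda>x. l2_dist n (f x) (g x)) \<in> borel_measurable M"
  unfolding l2_dist_def L2_set_def by measurable

lemma measurable_measurement [measurable (raw)]:
  assumes [measurable]: "f \<in> M \<rightarrow>\<^sub>M PiM ({..<m} \<times> {..<n}) (\<lambda>_. borel)" "h \<in> M \<rightarrow>\<^sub>M PiM {..<m} (\<lambda>_. borel)"
    "g \<in> M \<rightarrow>\<^sub>M PiM {..<n} (\<lambda>_. borel)"
  shows "(\<lambda>x. measurement m n (f x) (h x) (g x)) \<in> M \<rightarrow>\<^sub>M PiM {..<m} (\<lambda>_. borel)"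
  unfolding measurement_def
proof (intro measurable_restrict borel_measurable_add)
  fix i assume i: "i \<in> {..<m}"
  have "(\<lambda>x. matvec m n (f x) (g x)) \<in> M \<rightarrow>\<^sub>M PiM {..<m} (\<lambda>_. borel)" by measurable
  then show "(\<lambda>x. matvec m n (f x) (g x) i) \<in> borel_measurable M"
    using i by (rule measurable_compose[OF _ measurable_component_singleton])
  show "(\<lambda>x. h x i) \<in> borel_measurable M"
    using i by (rule measurable_compose[OF assms(2) measurable_component_singleton])
qed

lemma measurable_likelihood [measurable (raw)]:
  assumes [measurable]: "f \<in> M \<rightarrow>\<^sub>M PiM ({..<m} \<times> {..<n}) (\<lambda>_. borel)" "h \<in> M \<rightarrow>\<^sub>M PiM {..<m} (\<lambda>_. borel)"
    "g \<in> M \<rightarrow>\<^sub>M PiM {..<n} (\<lambda>_. borel)"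
  shows "(\<lambda>x. likelihood m n \<sigma> (f x) (h x) (g x)) \<in> borel_measurable M"
  unfolding likelihood_def by measurable

lemma likelihood_pos: "0 < likelihood m n \<sigma> A y x"
  by (simp add: likelihood_def)

lemma likelihood_le_1: "likelihood m n \<sigma> A y x \<le> 1"
  by (simp add: likelihood_def)

section \<open>Density of the observation\<close>

lemma normal_density_translate:
  assumes [measurable]: "S \<in> sets borel"
  shows "emeasure (density lborel (normal_density 0 s)) ((\<lambda>x. a + x) -` S) = emeasure (density lborel (normal_density a s)) S"
proof -
  have [measurable]: "(\<lambda>x. a + x) -` S \<in> sets borel"
    using measurable_sets_borel[of "\<lambda>x. a + x" borel S] by simp
  have "emeasure (density lborel (normal_density a s)) S
      = (\<integral>\<^sup>+x. ennreal (normal_density a s x) * indicator S x \<partial>lborel)"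
    by (simp add: emeasure_density)
  also have "\<dots> = (\<integral>\<^sup>+x. ennreal (normal_density a s (a + x)) * indicator S (a + x) \<partial>lborel)"
    by (subst nn_integral_real_affine[where c = 1 and t = a]) auto
  also have "\<dots> = emeasure (density lborel (normal_density 0 s)) ((\<lambda>x. a + x) -` S)"
    by (simp add: emeasure_density normal_density_def indicator_def vimage_def)
  finally show ?thesis ..
qed

text \<open>A product measure is determined by its values on boxes, and on a box both the density
  and the indicator factor over the coordinates.\<close>

lemma density_PiM:
  fixes f :: "'i \<Rightarrow> 'a \<Rightarrow> ennreal"
  assumes I: "finite I" and M: "\<And>i. sigma_finite_measure (M i)"
    and f: "\<And>i. f i \<in> borel_measurable (M i)" and D: "\<And>i. sigma_finite_measure (density (M i) (f i))"
  shows "density (PiM I M) (\<lambda>x. \<Prod>i\<in>I. f i (x i)) = PiM I (\<lambda>i. density (M i) (f i))"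
proof -
  interpret M: product_sigma_finite M using M by (rule product_sigma_finite.intro)
  interpret D: product_sigma_finite "\<lambda>i. density (M i) (f i)" using D by (rule product_sigma_finite.intro)
  show ?thesis
  proof (rule D.PiM_eqI[OF I])
    show "sets (density (PiM I M) (\<lambda>x. \<Prod>i\<in>I. f i (x i))) = sets (PiM I (\<lambda>i. density (M i) (f i)))"
      unfolding sets_density by (intro sets_PiM_cong) auto
    fix S assume "\<And>i. i \<in> I \<Longrightarrow> S i \<in> sets (density (M i) (f i))"
    then have S: "S i \<in> sets (M i)" if "i \<in> I" for i using that by simp
    have meas: "(\<lambda>x. \<Prod>i\<in>I. f i (x i)) \<in> borel_measurable (PiM I M)"
      using f by (intro borel_measurable_prod_ennreal) (rule measurable_compose[OF measurable_component_singleton])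
    have ind: "indicator (Pi\<^sub>E I S) x = (\<Prod>i\<in>I. indicator (S i) (x i) :: ennreal)" if x: "x \<in> space (PiM I M)" for x
    proof (cases "\<forall>i\<in>I. x i \<in> S i")
      case True
      then have "x \<in> Pi\<^sub>E I S" using x by (simp add: space_PiM PiE_iff)
      then show ?thesis using True by simp
    next
      case False
      then have "x \<notin> Pi\<^sub>E I S" by (auto simp: PiE_iff)
      moreover from False obtain i where "i \<in> I" "x i \<notin> S i" by blast
      then have "(\<Prod>i\<in>I. indicator (S i) (x i) :: ennreal) = 0"
        by (intro prod_zero[OF I] bexI[of _ i]) simp_all
      ultimately show ?thesis by simp
    qed
    have "emeasure (density (PiM I M) (\<lambda>x. \<Prod>i\<in>I. f i (x i))) (Pi\<^sub>E I S)
        = (\<integral>\<^sup>+x. (\<Prod>i\<in>I. f i (x i)) * indicator (Pi\<^sub>E I S) x \<partial>PiM I M)"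
      using I S by (intro emeasure_density[OF meas] sets_PiM_I_finite)
    also have "\<dots> = (\<integral>\<^sup>+x. (\<Prod>i\<in>I. f i (x i) * indicator (S i) (x i)) \<partial>PiM I M)"
      by (intro nn_integral_cong) (simp add: ind prod.distrib)
    also have "\<dots> = (\<Prod>i\<in>I. \<integral>\<^sup>+t. f i t * indicator (S i) t \<partial>M i)"
      using S f by (intro M.product_nn_integral_prod[OF I, of "\<lambda>i t. f i t * indicator (S i) t"]) simp
    also have "\<dots> = (\<Prod>i\<in>I. emeasure (density (M i) (f i)) (S i))"
      using S f by (intro prod.cong refl) (simp add: emeasure_density)
    finally show "emeasure (density (PiM I M) (\<lambda>x. \<Prod>i\<in>I. f i (x i))) (Pi\<^sub>E I S)
        = (\<Prod>i\<in>I. emeasure (density (M i) (f i)) (S i))" .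
  qed
qed

text \<open>\<open>likelihood\<close> is an unnormalized Gaussian; this factor makes it the Lebesgue
  density of the observation given \<open>A\<close> and \<open>x\<close>.\<close>

definition noise_density_const :: "nat \<Rightarrow> real \<Rightarrow> real" where
  "noise_density_const m \<sigma> = (1 / sqrt (2 * pi * (\<sigma>\<^sup>2 / real m))) ^ m"

text \<open>For fixed \<open>A\<close> and \<open>x\<close> the observation is the noise shifted by
  \<open>A x\<close>: its coordinates are independent normal variables with means
  \<open>(A x)_i\<close> and variance \<open>\<sigma>\<^sup>2 / m\<close>, and the product of their
  densities is the stated one.\<close>

lemma distr_measurement:
  assumes m: "1 \<le> m" and \<sigma>: "0 < \<sigma>"
  shows "distr (gaussian_noise m \<sigma>) (PiM {..<m} (\<lambda>_. borel)) (\<lambda>\<xi>. measurement m n A \<xi> x)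
    = density (PiM {..<m} (\<lambda>_. lborel)) (\<lambda>y. ennreal (noise_density_const m \<sigma> * likelihood m n \<sigma> A y x))"
proof -
  define a where "a = matvec m n A x"
  define s where "s = sqrt (\<sigma>\<^sup>2 / real m)"
  have s: "0 < s" "s\<^sup>2 = \<sigma>\<^sup>2 / real m" using m \<sigma> by (auto simp: s_def)
  define M where "M i = density lborel (normal_density (a i) s)" for i
  define N where "N = (\<lambda>_::nat. density lborel (normal_density 0 s))"
  have [simp]: "sets (M i) = sets borel" "space (M i) = UNIV" for i by (simp_all add: M_def)
  interpret M: product_sigma_finite M
    using s by (intro product_sigma_finite.intro prob_space_imp_sigma_finite) (simp add: M_def prob_space_normal_density)
  interpret N: product_sigma_finite N
    using s by (intro product_sigma_finite.intro prob_space_imp_sigma_finite) (simp add: N_def prob_space_normal_density)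
  have noise: "gaussian_noise m \<sigma> = PiM {..<m} N" by (simp add: gaussian_noise_def N_def s_def)
  have dens: "noise_density_const m \<sigma> * likelihood m n \<sigma> A y x = (\<Prod>i<m. normal_density (a i) s (y i))" for y
  proof -
    have "likelihood m n \<sigma> A y x = exp (\<Sum>i<m. - (y i - a i)\<^sup>2 / (2 * s\<^sup>2))"
      using m \<sigma> by (simp add: likelihood_def l2_dist_def L2_set_def sum_nonneg a_def s sum_divide_distrib[symmetric] sum_negf sum_distrib_left mult.commute)
    then show ?thesis
      by (simp add: normal_density_def prod.distrib exp_sum noise_density_const_def s power_one_over prod_dividef)
  qed
  have "distr (PiM {..<m} N) (PiM {..<m} (\<lambda>_. borel)) (\<lambda>\<xi>. measurement m n A \<xi> x) = PiM {..<m} M"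
  proof (rule M.PiM_eqI)
    show "sets (distr (PiM {..<m} N) (PiM {..<m} (\<lambda>_. borel)) (\<lambda>\<xi>. measurement m n A \<xi> x)) = sets (PiM {..<m} M)"
      unfolding sets_distr by (intro sets_PiM_cong) auto
    fix S assume S: "\<And>i. i \<in> {..<m} \<Longrightarrow> S i \<in> sets (M i)"
    have meas: "(\<lambda>\<xi>. measurement m n A \<xi> x) \<in> PiM {..<m} N \<rightarrow>\<^sub>M PiM {..<m} (\<lambda>_. borel)"
      unfolding measurement_def N_def by measurable
    have vi: "(\<lambda>x. a i + x) -` S i \<in> sets borel" if "i < m" for i
      using measurable_sets_borel[of "\<lambda>x. a i + x" borel "S i"] S[of i] that by simp
    have "(\<lambda>\<xi>. measurement m n A \<xi> x) -` (Pi\<^sub>E {..<m} S) \<inter> space (PiM {..<m} N)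
        = Pi\<^sub>E {..<m} (\<lambda>i. (\<lambda>x. a i + x) -` S i)"
      by (auto simp: measurement_def space_PiM PiE_iff N_def a_def)
    then have "emeasure (distr (PiM {..<m} N) (PiM {..<m} (\<lambda>_. borel)) (\<lambda>\<xi>. measurement m n A \<xi> x)) (Pi\<^sub>E {..<m} S)
        = emeasure (PiM {..<m} N) (Pi\<^sub>E {..<m} (\<lambda>i. (\<lambda>x. a i + x) -` S i))"
      using S by (subst emeasure_distr[OF meas]) (auto intro!: sets_PiM_I_finite)
    also have "\<dots> = (\<Prod>i<m. emeasure (N i) ((\<lambda>x. a i + x) -` S i))"
      using vi by (intro N.emeasure_PiM) (auto simp: N_def)
    also have "\<dots> = (\<Prod>i<m. emeasure (M i) (S i))"
      using S by (intro prod.cong refl) (auto simp: N_def M_def normal_density_translate)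
    finally show "emeasure (distr (PiM {..<m} N) (PiM {..<m} (\<lambda>_. borel)) (\<lambda>\<xi>. measurement m n A \<xi> x)) (Pi\<^sub>E {..<m} S)
        = (\<Prod>i<m. emeasure (M i) (S i))" .
  qed simp
  moreover have "density (PiM {..<m} (\<lambda>_. lborel)) (\<lambda>y. ennreal (noise_density_const m \<sigma> * likelihood m n \<sigma> A y x)) = PiM {..<m} M"
  proof -
    have "density (PiM {..<m} (\<lambda>_. lborel)) (\<lambda>y. \<Prod>i<m. ennreal (normal_density (a i) s (y i)))
        = PiM {..<m} (\<lambda>i. density lborel (normal_density (a i) s))"
      using s by (intro density_PiM[of _ _ "\<lambda>i t. ennreal (normal_density (a i) s t)"])
        (auto intro!: sigma_finite_lborel prob_space_imp_sigma_finite prob_space_normal_density)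
    then show ?thesis unfolding dens M_def by (simp add: prod_ennreal)
  qed
  ultimately show ?thesis by (simp add: noise)
qed

text \<open>Trades the average over the noise for an integral over \<open>y\<close> against a
  reference measure that does not depend on \<open>x\<close>. Integrals over signals and
  observations can then be exchanged, with \<open>x\<close> entering through the likelihood.\<close>

lemma nn_integral_measurement:
  assumes m: "1 \<le> m" and \<sigma>: "0 < \<sigma>" and x: "x \<in> space (Rn n)"
    and A: "A \<in> space (gaussian_matrix m n)"
    and h [measurable]: "h \<in> borel_measurable (PiM {..<m} (\<lambda>_. borel))"
  shows "(\<integral>\<^sup>+\<xi>. h (measurement m n A \<xi> x) \<partial>gaussian_noise m \<sigma>)
    = (\<integral>\<^sup>+y. ennreal (noise_density_const m \<sigma> * likelihood m n \<sigma> A y x) * h y \<partial>PiM {..<m} (\<lambda>_. lborel))"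
proof -
  have [measurable]: "x \<in> space (PiM {..<n} (\<lambda>_. borel))" "A \<in> space (PiM ({..<m} \<times> {..<n}) (\<lambda>_. borel))"
    using x A sets_eq_imp_space_eq[OF sets_gaussian_matrix] by (auto simp: Rn_def)
  have [measurable_cong]: "sets (PiM {..<m} (\<lambda>_. lborel)) = sets (PiM {..<m} (\<lambda>_. borel :: real measure))"
    by (intro sets_PiM_cong) auto
  have "(\<integral>\<^sup>+\<xi>. h (measurement m n A \<xi> x) \<partial>gaussian_noise m \<sigma>)
      = (\<integral>\<^sup>+y. h y \<partial>distr (gaussian_noise m \<sigma>) (PiM {..<m} (\<lambda>_. borel)) (\<lambda>\<xi>. measurement m n A \<xi> x))"
    by (intro nn_integral_distr[symmetric]) measurable
  also have "\<dots> = (\<integral>\<^sup>+y. ennreal (noise_density_const m \<sigma> * likelihood m n \<sigma> A y x) * h y \<partial>PiM {..<m} (\<lambda>_. lborel))"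
    unfolding distr_measurement[OF m \<sigma>] by (intro nn_integral_density) measurable
  finally show ?thesis .
qed

section \<open>Posterior mass far from a centre\<close>

lemma nn_integral_if_eq_emeasure:
  assumes [measurable]: "Measurable.pred M R"
  shows "(\<integral>\<^sup>+x. (if R x then 1 else 0) \<partial>M) = emeasure M {x \<in> space M. R x}"
proof -
  have "(\<integral>\<^sup>+x. (if R x then 1 else 0) \<partial>M) = (\<integral>\<^sup>+x. indicator {x \<in> space M. R x} x \<partial>M)"
    by (intro nn_integral_cong) auto
  then show ?thesis by simp
qed

locale posterior_sampling =
  fixes m n :: nat and \<sigma> :: real and P :: "(nat \<Rightarrow> real) measure"
  assumes m: "1 \<le> m" and \<sigma>: "0 < \<sigma>" and P: "P \<in> space (prob_algebra (Rn n))"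
begin

abbreviation "G \<equiv> gaussian_matrix m n"
abbreviation "N \<equiv> gaussian_noise m \<sigma>"
abbreviation "Y \<equiv> PiM {..<m} (\<lambda>_. lborel :: real measure)"
abbreviation "obs \<equiv> measurement m n"
abbreviation "lik \<equiv> likelihood m n \<sigma>"

lemma sets_P [measurable_cong]: "sets P = sets (PiM {..<n} (\<lambda>_. borel))"
  using P by (simp add: space_prob_algebra Rn_def)

lemma sets_Y [measurable_cong]: "sets Y = sets (PiM {..<m} (\<lambda>_. borel))"
  by (intro sets_PiM_cong) auto

lemma space_P: "space P = space (Rn n)"
  by (rule sets_eq_imp_space_eq) (simp add: sets_P sets_Rn)

sublocale P: prob_space P
  using P by (simp add: space_prob_algebra)

sublocale G: prob_space G
  unfolding gaussian_matrix_def using m by (intro prob_space_PiM prob_space_normal_density) simp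

sublocale N: prob_space N
  unfolding gaussian_noise_def using m \<sigma> by (intro prob_space_PiM prob_space_normal_density) simp

sublocale Y: sigma_finite_measure Y
proof -
  interpret product_sigma_finite "\<lambda>_::nat. lborel :: real measure"
    by (intro product_sigma_finite.intro) (rule sigma_finite_lborel)
  show "sigma_finite_measure Y" by (rule sigma_finite) simp
qed

text \<open>Up to the factor \<open>noise_density_const m \<sigma>\<close>, this is the marginal
  density of \<open>y\<close> given \<open>A\<close> when the signal is drawn from
  \<open>P\<close>.\<close>

definition evidence :: "(nat \<times> nat \<Rightarrow> real) \<Rightarrow> (nat \<Rightarrow> real) \<Rightarrow> ennreal" where
  "evidence A y = (\<integral>\<^sup>+x. ennreal (lik A y x) \<partial>P)"

text \<open>The posterior probability of \<open>S\<close> (see \<open>emeasure_posterior\<close>),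
  written as a quotient so that the denominator can be cancelled against an average of
  likelihoods.\<close>

definition posterior_mass :: "(nat \<Rightarrow> real) set \<Rightarrow> (nat \<times> nat \<Rightarrow> real) \<Rightarrow> (nat \<Rightarrow> real) \<Rightarrow> ennreal" where
  "posterior_mass S A y = (\<integral>\<^sup>+x. ennreal (lik A y x) * indicator S x \<partial>P) / evidence A y"

lemma measurable_evidence [measurable (raw)]:
  assumes [measurable]: "f \<in> M \<rightarrow>\<^sub>M PiM ({..<m} \<times> {..<n}) (\<lambda>_. borel)" "h \<in> M \<rightarrow>\<^sub>M PiM {..<m} (\<lambda>_. borel)"
  shows "(\<lambda>x. evidence (f x) (h x)) \<in> borel_measurable M"
  unfolding evidence_def by measurable

lemma measurable_posterior_mass [measurable (raw)]:
  assumes [measurable]: "f \<in> M \<rightarrow>\<^sub>M PiM ({..<m} \<times> {..<n}) (\<lambda>_. borel)" "h \<in> M \<rightarrow>\<^sub>M PiM {..<m} (\<lambda>_. borel)"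
    "S \<in> sets (Rn n)"
  shows "(\<lambda>x. posterior_mass S (f x) (h x)) \<in> borel_measurable M"
proof -
  have [measurable]: "S \<in> sets (PiM {..<n} (\<lambda>_. borel))" using assms(3) by (simp add: sets_Rn)
  show ?thesis unfolding posterior_mass_def by measurable
qed

lemma evidence_le_1: "evidence A y \<le> 1"
proof -
  have "evidence A y \<le> (\<integral>\<^sup>+x. 1 \<partial>P)"
    unfolding evidence_def by (intro nn_integral_mono) (simp add: likelihood_le_1)
  then show ?thesis by (simp add: P.emeasure_space_1)
qed

text \<open>The likelihood is strictly positive everywhere, so its integral over a probability
  measure cannot vanish. Hence the posterior is a genuine quotient.\<close>

lemma evidence_pos:
  assumes "A \<in> space G" "y \<in> space (PiM {..<m} (\<lambda>_. borel))"
  shows "evidence A y \<noteq> 0"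
proof
  assume 0: "evidence A y = 0"
  have [measurable]: "A \<in> space (PiM ({..<m} \<times> {..<n}) (\<lambda>_. borel))" "y \<in> space (PiM {..<m} (\<lambda>_. borel))"
    using assms sets_eq_imp_space_eq[OF sets_gaussian_matrix] by auto
  have "AE x in P. ennreal (lik A y x) = 0"
    using 0 unfolding evidence_def by (subst (asm) nn_integral_0_iff_AE) measurable
  then have "AE x in P. False"
    by eventually_elim (metis ennreal_eq_0_iff likelihood_pos not_le)
  then show False by simp
qed

lemma evidence_times_posterior_mass:
  assumes "A \<in> space G" "y \<in> space (PiM {..<m} (\<lambda>_. borel))"
  shows "evidence A y * posterior_mass S A y = (\<integral>\<^sup>+x. ennreal (lik A y x) * indicator S x \<partial>P)"
proof -
  have "evidence A y \<noteq> top" using evidence_le_1[of A y] by (auto simp: top_unique)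
  with evidence_pos[OF assms] show ?thesis
    unfolding posterior_mass_def ennreal_times_divide mult.commute[of "evidence A y"]
    by (rule mult_divide_eq_ennreal)
qed

lemma posterior_mass_le_1: "posterior_mass S A y \<le> 1"
proof -
  have "posterior_mass S A y \<le> evidence A y / evidence A y"
    unfolding posterior_mass_def evidence_def
    by (intro divide_right_mono_ennreal nn_integral_mono) (simp add: indicator_def)
  also have "\<dots> \<le> 1"
  \<comment> \<open>Neither \<open>A\<close> nor \<open>y\<close> is assumed to lie in its space
    here, so zero evidence is treated too: in \<open>ennreal\<close> the quotient 0 / 0 is
    0.\<close>
  proof (cases "evidence A y = 0")
    case False
    have "evidence A y < top" using evidence_le_1[of A y] by (rule order_le_less_trans) simp
    with False show ?thesis by (simp add: ennreal_divide_self)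
  qed simp
  finally show ?thesis .
qed

text \<open>The change of measure from \<open>u = fst w\<close> to \<open>v = snd w\<close>. Since
  \<open>v\<close> has law \<open>P\<close>, averaging its likelihood reproduces the denominator of
  the posterior mass. After the cancellation no posterior is left: the right-hand side concerns a
  fresh signal from \<open>P\<close> that lies in \<open>S\<close> and is observed near
  \<open>A x0\<close>.\<close>

lemma nn_integral_couple_posterior_mass_le:
  assumes \<gamma>: "\<gamma> \<in> space (prob_algebra (Rn n \<Otimes>\<^sub>M Rn n))" and snd: "distr \<gamma> (Rn n) snd = P"
    and S: "S \<in> sets (Rn n)" and A: "A \<in> space G" and x0: "x0 \<in> space (Rn n)" and \<rho>: "\<sigma> \<le> \<rho>"
  shows "(\<integral>\<^sup>+w. \<integral>\<^sup>+\<xi>.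
      (if l2_dist m (obs A \<xi> (fst w)) (matvec m n A (fst w)) \<le> 2 * \<sigma>
         \<and> l2_dist m (matvec m n A (fst w)) (matvec m n A (snd w)) \<le> 2 * \<sigma>
         \<and> l2_dist m (matvec m n A (fst w)) (matvec m n A x0) \<le> 2 * \<rho>
       then posterior_mass S A (obs A \<xi> (fst w)) else 0) \<partial>N \<partial>\<gamma>)
    \<le> ennreal (exp (8 * real m)) *
      (\<integral>\<^sup>+x. indicator S x * (\<integral>\<^sup>+\<xi>. (if l2_dist m (obs A \<xi> x) (matvec m n A x0) \<le> 4 * \<rho> then 1 else 0) \<partial>N) \<partial>P)"
proof -
  define \<kappa> where "\<kappa> = noise_density_const m \<sigma>"
  have \<kappa>: "0 \<le> \<kappa>" by (simp add: \<kappa>_def noise_density_const_def)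
  interpret \<gamma>: prob_space \<gamma> using \<gamma> by (simp add: space_prob_algebra)
  have sets_\<gamma>[measurable_cong]: "sets \<gamma> = sets (PiM {..<n} (\<lambda>_. borel) \<Otimes>\<^sub>M PiM {..<n} (\<lambda>_. borel))"
    using \<gamma> by (simp add: space_prob_algebra Rn_def)
  have space_\<gamma>: "fst w \<in> space (Rn n)" "snd w \<in> space (Rn n)" if "w \<in> space \<gamma>" for w
  proof -
    have "w \<in> space (Rn n \<Otimes>\<^sub>M Rn n)"
      using that unfolding Rn_def sets_eq_imp_space_eq[OF sets_\<gamma>] .
    then show "fst w \<in> space (Rn n)" "snd w \<in> space (Rn n)"
      by (simp_all add: space_pair_measure mem_Times_iff)
  qed
  have [measurable]: "A \<in> space (PiM ({..<m} \<times> {..<n}) (\<lambda>_. borel))"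
    using A sets_eq_imp_space_eq[OF sets_gaussian_matrix] by auto
  have x0'[measurable]: "x0 \<in> space (PiM {..<n} (\<lambda>_. borel))" using x0 by (simp add: Rn_def)
  have S'[measurable]: "S \<in> sets (PiM {..<n} (\<lambda>_. borel))" using S by (simp add: sets_Rn)
  have Ysp: "space Y = space (PiM {..<m} (\<lambda>_. borel))" by (rule sets_eq_imp_space_eq[OF sets_Y])
  interpret \<gamma>Y: pair_sigma_finite \<gamma> Y ..
  interpret PY: pair_sigma_finite P Y ..
  \<comment> \<open>The radius is \<open>2 * \<sigma> + 2 * \<rho>\<close>, enlarged by
    \<open>\<sigma> \<le> \<rho>\<close>. This condition on \<open>y\<close> no longer mentions
    \<open>w\<close>, so it survives integrating out the coupling.\<close>
  define near where "near y \<longleftrightarrow> l2_dist m y (matvec m n A x0) \<le> 4 * \<rho>" for y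
  have [measurable]: "Measurable.pred (PiM {..<m} (\<lambda>_. borel)) near" unfolding near_def by measurable
  \<comment> \<open>Collects all factors that depend on \<open>y\<close> alone; the comparison below
    leaves the likelihood of \<open>snd w\<close> as the only factor involving the coupling.\<close>
  define g where "g y = ennreal \<kappa> * (if near y then posterior_mass S A y else 0)" for y
  have [measurable]: "g \<in> borel_measurable (PiM {..<m} (\<lambda>_. borel))" unfolding g_def by measurable
  define h where "h w y = (if l2_dist m y (matvec m n A (fst w)) \<le> 2 * \<sigma>
         \<and> l2_dist m (matvec m n A (fst w)) (matvec m n A (snd w)) \<le> 2 * \<sigma>
         \<and> l2_dist m (matvec m n A (fst w)) (matvec m n A x0) \<le> 2 * \<rho>
       then posterior_mass S A y else 0)" for w y
  \<comment> \<open>The two bounds \<open>2 * \<sigma>\<close> put \<open>y\<close> within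
    \<open>4 * \<sigma>\<close> of the image of \<open>snd w\<close>. The exponent of that
    likelihood is then at most
    \<open>m * (4 * \<sigma>)\<^sup>2 / (2 * \<sigma>\<^sup>2) = 8 * m\<close>, and the likelihood
    of \<open>fst w\<close> is at most 1.\<close>
  have le: "ennreal (\<kappa> * lik A y (fst w)) * h w y
      \<le> ennreal (exp (8 * real m)) * (ennreal (lik A y (snd w)) * g y)" for w y
  proof (cases "l2_dist m y (matvec m n A (fst w)) \<le> 2 * \<sigma>
         \<and> l2_dist m (matvec m n A (fst w)) (matvec m n A (snd w)) \<le> 2 * \<sigma>
         \<and> l2_dist m (matvec m n A (fst w)) (matvec m n A x0) \<le> 2 * \<rho>")
    case True
    have "near y"
      using True \<rho> l2_dist_triangle[of m y "matvec m n A x0" "matvec m n A (fst w)"] by (simp add: near_def)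
    have "l2_dist m y (matvec m n A (snd w)) \<le> 4 * \<sigma>"
      using True l2_dist_triangle[of m y "matvec m n A (snd w)" "matvec m n A (fst w)"] by simp
    then have "(l2_dist m y (matvec m n A (snd w)))\<^sup>2 \<le> (4 * \<sigma>)\<^sup>2" by (intro power_mono) auto
    then have "real m * (l2_dist m y (matvec m n A (snd w)))\<^sup>2 / (2 * \<sigma>\<^sup>2) \<le> real m * (4 * \<sigma>)\<^sup>2 / (2 * \<sigma>\<^sup>2)"
      by (intro divide_right_mono mult_left_mono) auto
    also have "\<dots> = 8 * real m" using \<sigma> by (simp add: power_mult_distrib)
    finally have "exp (- (8 * real m)) \<le> lik A y (snd w)" by (simp add: likelihood_def)
    then have "exp (8 * real m) * exp (- (8 * real m)) \<le> exp (8 * real m) * lik A y (snd w)"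
      by (intro mult_left_mono) auto
    then have "lik A y (fst w) \<le> exp (8 * real m) * lik A y (snd w)"
      using likelihood_le_1[of m n \<sigma> A y "fst w"] by (simp add: exp_add[symmetric])
    then have "\<kappa> * lik A y (fst w) \<le> exp (8 * real m) * (lik A y (snd w) * \<kappa>)"
      using mult_left_mono[OF _ \<kappa>] by (fastforce simp: algebra_simps)
    then have "ennreal (\<kappa> * lik A y (fst w)) * h w y
        \<le> ennreal (exp (8 * real m) * (lik A y (snd w) * \<kappa>)) * posterior_mass S A y"
      unfolding h_def if_P[OF True] by (rule mult_right_mono[OF ennreal_leI]) simp_all
    also have "\<dots> = ennreal (exp (8 * real m)) * (ennreal (lik A y (snd w)) * g y)"
      using \<open>near y\<close> \<kappa> by (simp add: g_def ennreal_mult' ennreal_mult likelihood_pos less_imp_le mult.assoc)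
    finally show ?thesis .
  next
    case False
    then show ?thesis by (auto simp: h_def)
  qed
  have "(\<integral>\<^sup>+w. \<integral>\<^sup>+\<xi>. h w (obs A \<xi> (fst w)) \<partial>N \<partial>\<gamma>)
      = (\<integral>\<^sup>+w. \<integral>\<^sup>+y. ennreal (\<kappa> * lik A y (fst w)) * h w y \<partial>Y \<partial>\<gamma>)"
  proof (intro nn_integral_cong)
    fix w assume w: "w \<in> space \<gamma>"
    have [measurable]: "fst w \<in> space (PiM {..<n} (\<lambda>_. borel))" "snd w \<in> space (PiM {..<n} (\<lambda>_. borel))"
      using space_\<gamma>[OF w] by (simp_all add: Rn_def)
    have "h w \<in> borel_measurable (PiM {..<m} (\<lambda>_. borel))" unfolding h_def by measurable
    then show "(\<integral>\<^sup>+\<xi>. h w (obs A \<xi> (fst w)) \<partial>N) = (\<integral>\<^sup>+y. ennreal (\<kappa> * lik A y (fst w)) * h w y \<partial>Y)"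
      unfolding \<kappa>_def by (rule nn_integral_measurement[OF m \<sigma> space_\<gamma>(1)[OF w] A])
  qed
  also have "\<dots> \<le> (\<integral>\<^sup>+w. \<integral>\<^sup>+y. ennreal (exp (8 * real m)) * (ennreal (lik A y (snd w)) * g y) \<partial>Y \<partial>\<gamma>)"
    using le by (intro nn_integral_mono)
  \<comment> \<open>With \<open>y\<close> outermost, the inner integral over the coupling sees only
    the second marginal and becomes the evidence.\<close>
  also have "\<dots> = (\<integral>\<^sup>+y. \<integral>\<^sup>+w. ennreal (exp (8 * real m)) * (ennreal (lik A y (snd w)) * g y) \<partial>\<gamma> \<partial>Y)"
    by (rule \<gamma>Y.Fubini'[symmetric]) measurable
  also have "\<dots> = (\<integral>\<^sup>+y. ennreal (exp (8 * real m)) * (evidence A y * g y) \<partial>Y)"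
  proof (intro nn_integral_cong)
    fix y assume "y \<in> space Y"
    then have y[measurable]: "y \<in> space (PiM {..<m} (\<lambda>_. borel))" by (simp add: Ysp)
    have "(\<integral>\<^sup>+w. ennreal (lik A y (snd w)) \<partial>\<gamma>) = evidence A y"
    proof -
      have "(\<integral>\<^sup>+w. ennreal (lik A y (snd w)) \<partial>\<gamma>) = (\<integral>\<^sup>+x. ennreal (lik A y x) \<partial>distr \<gamma> (Rn n) snd)"
        by (subst nn_integral_distr) measurable
      then show ?thesis by (simp only: snd evidence_def)
    qed
    then show "(\<integral>\<^sup>+w. ennreal (exp (8 * real m)) * (ennreal (lik A y (snd w)) * g y) \<partial>\<gamma>)
        = ennreal (exp (8 * real m)) * (evidence A y * g y)"
      by (simp add: nn_integral_cmult nn_integral_multc)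
  qed
  also have "\<dots> = ennreal (exp (8 * real m)) * (\<integral>\<^sup>+y. evidence A y * g y \<partial>Y)"
    by (rule nn_integral_cmult) measurable
  \<comment> \<open>Evidence times posterior mass is the unnormalized mass of \<open>S\<close>.
    Multiplied by \<open>\<kappa>\<close>, it is read backwards as the density of observations of
    signals \<open>x\<close> in \<open>S\<close>.\<close>
  also have "(\<integral>\<^sup>+y. evidence A y * g y \<partial>Y)
      = (\<integral>\<^sup>+y. \<integral>\<^sup>+x. ennreal (\<kappa> * lik A y x) * (indicator S x * (if near y then 1 else 0)) \<partial>P \<partial>Y)"
  proof (intro nn_integral_cong)
    fix y assume "y \<in> space Y"
    then have y[measurable]: "y \<in> space (PiM {..<m} (\<lambda>_. borel))" by (simp add: Ysp)
    have "evidence A y * g y = (ennreal \<kappa> * (if near y then 1 else 0)) * (evidence A y * posterior_mass S A y)"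
      by (simp add: g_def mult_ac)
    also have "\<dots> = (\<integral>\<^sup>+x. (ennreal \<kappa> * (if near y then 1 else 0)) * (ennreal (lik A y x) * indicator S x) \<partial>P)"
      unfolding evidence_times_posterior_mass[OF A y] by (rule nn_integral_cmult[symmetric]) measurable
    also have "\<dots> = (\<integral>\<^sup>+x. ennreal (\<kappa> * lik A y x) * (indicator S x * (if near y then 1 else 0)) \<partial>P)"
      using \<kappa> by (intro nn_integral_cong) (simp add: ennreal_mult' mult_ac)
    finally show "evidence A y * g y
        = (\<integral>\<^sup>+x. ennreal (\<kappa> * lik A y x) * (indicator S x * (if near y then 1 else 0)) \<partial>P)" .
  qed
  also have "\<dots> = (\<integral>\<^sup>+x. \<integral>\<^sup>+y. ennreal (\<kappa> * lik A y x) * (indicator S x * (if near y then 1 else 0)) \<partial>Y \<partial>P)"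
    by (rule PY.Fubini') measurable
  also have "\<dots> = (\<integral>\<^sup>+x. indicator S x * (\<integral>\<^sup>+\<xi>. (if near (obs A \<xi> x) then 1 else 0) \<partial>N) \<partial>P)"
  proof (intro nn_integral_cong)
    fix x assume x: "x \<in> space P"
    then have x'[measurable]: "x \<in> space (PiM {..<n} (\<lambda>_. borel))" by (simp add: space_P Rn_def)
    have "(\<integral>\<^sup>+y. ennreal (\<kappa> * lik A y x) * (indicator S x * (if near y then 1 else 0)) \<partial>Y)
        = (\<integral>\<^sup>+y. indicator S x * (ennreal (\<kappa> * lik A y x) * (if near y then 1 else 0)) \<partial>Y)"
      by (simp add: mult_ac)
    also have "\<dots> = indicator S x * (\<integral>\<^sup>+y. ennreal (\<kappa> * lik A y x) * (if near y then 1 else 0) \<partial>Y)"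
      by (rule nn_integral_cmult) measurable
    also have "(\<integral>\<^sup>+y. ennreal (\<kappa> * lik A y x) * (if near y then 1 else 0) \<partial>Y)
        = (\<integral>\<^sup>+\<xi>. (if near (obs A \<xi> x) then 1 else 0) \<partial>N)"
      unfolding \<kappa>_def using x by (intro nn_integral_measurement[symmetric, OF m \<sigma> _ A]) (auto simp: space_P)
    finally show "(\<integral>\<^sup>+y. ennreal (\<kappa> * lik A y x) * (indicator S x * (if near y then 1 else 0)) \<partial>Y)
        = indicator S x * (\<integral>\<^sup>+\<xi>. (if near (obs A \<xi> x) then 1 else 0) \<partial>N)" .
  qed
  finally show ?thesis by (simp only: h_def near_def)
qed

lemma nn_integral_matrix_noise_add:
  assumes [measurable]: "f \<in> borel_measurable (PiM {..<m} (\<lambda>_. borel))"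
    "g \<in> borel_measurable (PiM ({..<m} \<times> {..<n}) (\<lambda>_. borel))"
  shows "(\<integral>\<^sup>+A. \<integral>\<^sup>+\<xi>. f \<xi> + g A \<partial>N \<partial>G) = (\<integral>\<^sup>+\<xi>. f \<xi> \<partial>N) + (\<integral>\<^sup>+A. g A \<partial>G)"
  by (simp add: nn_integral_add N.emeasure_space_1 G.emeasure_space_1)

text \<open>For fixed \<open>x\<close> in \<open>S\<close>, an observation within
  \<open>4 * \<rho>\<close> of \<open>A x0\<close> requires noise larger than
  \<open>6 * \<sigma>\<close> or an image distance of at most
  \<open>4 * \<rho> + 6 * \<sigma> \<le> 10 * \<rho>\<close>. The latter means that \<open>A\<close>
  shrinks the distance, at least \<open>10 * exp 9 * \<rho>\<close>, by the factor
  \<open>exp (- 9)\<close>.\<close>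

lemma nn_integral_far_observed_near_le:
  assumes x0: "x0 \<in> space (Rn n)" and \<rho>: "\<sigma> \<le> \<rho>"
    and S: "S = {x \<in> space (Rn n). 10 * exp 9 * \<rho> \<le> l2_dist n x0 x}"
  shows "(\<integral>\<^sup>+A. \<integral>\<^sup>+x. indicator S x *
      (\<integral>\<^sup>+\<xi>. (if l2_dist m (obs A \<xi> x) (matvec m n A x0) \<le> 4 * \<rho> then 1 else 0) \<partial>N) \<partial>P \<partial>G)
    \<le> ennreal (2 * exp (real m * (- 17 / 2)))"
proof -
  have x0'[measurable]: "x0 \<in> space (PiM {..<n} (\<lambda>_. borel))" using x0 by (simp add: Rn_def)
  have [measurable]: "S \<in> sets (PiM {..<n} (\<lambda>_. borel))"
    unfolding S Rn_def by measurable
  interpret GP: pair_sigma_finite G P ..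
  have "(\<integral>\<^sup>+A. \<integral>\<^sup>+x. indicator S x *
      (\<integral>\<^sup>+\<xi>. (if l2_dist m (obs A \<xi> x) (matvec m n A x0) \<le> 4 * \<rho> then 1 else 0) \<partial>N) \<partial>P \<partial>G)
    = (\<integral>\<^sup>+x. \<integral>\<^sup>+A. indicator S x *
      (\<integral>\<^sup>+\<xi>. (if l2_dist m (obs A \<xi> x) (matvec m n A x0) \<le> 4 * \<rho> then 1 else 0) \<partial>N) \<partial>G \<partial>P)"
    by (rule GP.Fubini'[symmetric]) measurable
  also have "\<dots> \<le> (\<integral>\<^sup>+x. ennreal (2 * exp (real m * (- 17 / 2))) \<partial>P)"
  proof (intro nn_integral_mono)
    fix x assume "x \<in> space P"
    then have x: "x \<in> space (Rn n)" by (simp add: space_P)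
    then have [measurable]: "x \<in> space (PiM {..<n} (\<lambda>_. borel))" by (simp add: Rn_def)
    show "(\<integral>\<^sup>+A. indicator S x *
        (\<integral>\<^sup>+\<xi>. (if l2_dist m (obs A \<xi> x) (matvec m n A x0) \<le> 4 * \<rho> then 1 else 0) \<partial>N) \<partial>G)
      \<le> ennreal (2 * exp (real m * (- 17 / 2)))"
    proof (cases "x \<in> S")
      case True
      define d where "d = 10 * exp 9 * \<rho>"
      have d: "0 < d" "d \<le> l2_dist n x x0"
        using \<sigma> \<rho> True by (auto simp: d_def S l2_dist_commute)
      have d': "exp (- 9) * d = 10 * \<rho>" by (simp add: d_def exp_minus)
      have "(\<integral>\<^sup>+A. indicator S x *
          (\<integral>\<^sup>+\<xi>. (if l2_dist m (obs A \<xi> x) (matvec m n A x0) \<le> 4 * \<rho> then 1 else 0) \<partial>N) \<partial>G)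
        \<le> (\<integral>\<^sup>+A. \<integral>\<^sup>+\<xi>. (if 6 * \<sigma> < L2_set \<xi> {..<m} then 1 else 0)
            + (if l2_dist m (matvec m n A x) (matvec m n A x0) \<le> exp (- 9) * d then 1 else 0) \<partial>N \<partial>G)"
        unfolding d'
      proof (intro nn_integral_mono)
        fix A
        have "(if l2_dist m (obs A \<xi> x) (matvec m n A x0) \<le> 4 * \<rho> then 1 else 0)
            \<le> (if 6 * \<sigma> < L2_set \<xi> {..<m} then 1 else 0)
              + (if l2_dist m (matvec m n A x) (matvec m n A x0) \<le> 10 * \<rho> then 1 else (0::ennreal))" for \<xi>
          using l2_dist_triangle[of m "matvec m n A x" "matvec m n A x0" "obs A \<xi> x"] \<rho>
            l2_dist_measurement[of m n A \<xi> x] by (auto simp: l2_dist_commute)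
        then show "indicator S x *
            (\<integral>\<^sup>+\<xi>. (if l2_dist m (obs A \<xi> x) (matvec m n A x0) \<le> 4 * \<rho> then 1 else 0) \<partial>N)
          \<le> (\<integral>\<^sup>+\<xi>. (if 6 * \<sigma> < L2_set \<xi> {..<m} then 1 else 0)
              + (if l2_dist m (matvec m n A x) (matvec m n A x0) \<le> 10 * \<rho> then 1 else 0) \<partial>N)"
          using True by (simp add: nn_integral_mono)
      qed
      also have "\<dots> = (\<integral>\<^sup>+\<xi>. (if 6 * \<sigma> < L2_set \<xi> {..<m} then 1 else 0) \<partial>N)
          + (\<integral>\<^sup>+A. (if l2_dist m (matvec m n A x) (matvec m n A x0) \<le> exp (- 9) * d then 1 else 0) \<partial>G)"
        by (rule nn_integral_matrix_noise_add) measurable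
      also have "\<dots> = emeasure N {\<xi> \<in> space N. 6 * \<sigma> < L2_set \<xi> {..<m}}
          + emeasure G {A \<in> space G. l2_dist m (matvec m n A x) (matvec m n A x0) \<le> exp (- 9) * d}"
        by (subst (1 2) nn_integral_if_eq_emeasure) measurable
      \<comment> \<open>The constants 6 and 9 are matched: \<open>1/2 - 36/4\<close> and
        \<open>1/2 - 9\<close> are both \<open>- 17/2\<close>, a rate larger than the 8 lost in the
        change of measure.\<close>
      also have "\<dots> \<le> ennreal (exp (real m * (1 / 2 - 6\<^sup>2 / 4))) + ennreal ((exp (1 / 2) * exp (- 9)) ^ m)"
        using m \<sigma> d x x0
        by (intro add_mono emeasure_gaussian_noise_large emeasure_gaussian_matrix_contracts) auto
      also have "\<dots> = ennreal (2 * exp (real m * (- 17 / 2)))"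
        by (simp add: exp_add[symmetric] exp_of_nat_mult[symmetric] ennreal_plus[symmetric] del: ennreal_plus)
      finally show ?thesis .
    qed simp
  qed
  also have "\<dots> = ennreal (2 * exp (real m * (- 17 / 2)))" by (simp add: P.emeasure_space_1)
  finally show ?thesis .
qed

text \<open>The three exceptional events (large noise, \<open>A\<close> expanding
  \<open>u - v\<close>, \<open>A\<close> expanding \<open>u - x0\<close>) cost
  \<open>exp (- m / 2)\<close> each. On the rest the change of measure costs
  \<open>exp (8 m)\<close> and gains \<open>2 exp (- 17 m / 2)\<close>. Together this is
  \<open>5 exp (- m / 2)\<close>.\<close>

lemma expected_far_posterior_mass_le:
  assumes \<gamma>: "\<gamma> \<in> space (prob_algebra (Rn n \<Otimes>\<^sub>M Rn n))" and snd: "distr \<gamma> (Rn n) snd = P"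
    and x0: "x0 \<in> space (Rn n)" and \<rho>: "\<sigma> \<le> \<rho>"
    and S: "S = {x \<in> space (Rn n). 10 * exp 9 * \<rho> \<le> l2_dist n x0 x}"
  shows "(\<integral>\<^sup>+A. \<integral>\<^sup>+\<xi>. \<integral>\<^sup>+w.
      (if l2_dist n (fst w) (snd w) \<le> \<sigma> \<and> l2_dist n x0 (fst w) \<le> \<rho>
       then posterior_mass S A (obs A \<xi> (fst w)) else 0) \<partial>\<gamma> \<partial>N \<partial>G)
    \<le> ennreal (5 * exp (- (real m / 2)))"
proof -
  interpret \<gamma>: prob_space \<gamma> using \<gamma> by (simp add: space_prob_algebra)
  have sets_\<gamma>[measurable_cong]: "sets \<gamma> = sets (PiM {..<n} (\<lambda>_. borel) \<Otimes>\<^sub>M PiM {..<n} (\<lambda>_. borel))"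
    using \<gamma> by (simp add: space_prob_algebra Rn_def)
  have space_\<gamma>: "fst w \<in> space (Rn n)" "snd w \<in> space (Rn n)" if "w \<in> space \<gamma>" for w
  proof -
    have "w \<in> space (Rn n \<Otimes>\<^sub>M Rn n)"
      using that unfolding Rn_def sets_eq_imp_space_eq[OF sets_\<gamma>] .
    then show "fst w \<in> space (Rn n)" "snd w \<in> space (Rn n)"
      by (simp_all add: space_pair_measure mem_Times_iff)
  qed
  have x0'[measurable]: "x0 \<in> space (PiM {..<n} (\<lambda>_. borel))" using x0 by (simp add: Rn_def)
  have S'[measurable]: "S \<in> sets (Rn n)"
    unfolding S by measurable
  interpret N\<gamma>: pair_sigma_finite N \<gamma> ..
  interpret G\<gamma>: pair_sigma_finite G \<gamma> ..
  define cell where "cell w \<longleftrightarrow> l2_dist n (fst w) (snd w) \<le> \<sigma> \<and> l2_dist n x0 (fst w) \<le> \<rho>" for w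
  have [measurable]: "Measurable.pred (PiM {..<n} (\<lambda>_. borel) \<Otimes>\<^sub>M PiM {..<n} (\<lambda>_. borel)) cell"
    unfolding cell_def by measurable
  define noisy :: "(nat \<Rightarrow> real) \<Rightarrow> ennreal" where "noisy \<xi> = (if 2 * \<sigma> < L2_set \<xi> {..<m} then 1 else 0)" for \<xi>
  define expands :: "(nat \<times> nat \<Rightarrow> real) \<Rightarrow> (nat \<Rightarrow> real) \<times> (nat \<Rightarrow> real) \<Rightarrow> ennreal" where
    "expands A w = (if 2 * \<sigma> < l2_dist m (matvec m n A (fst w)) (matvec m n A (snd w)) then 1 else 0)
      + (if 2 * \<rho> < l2_dist m (matvec m n A (fst w)) (matvec m n A x0) then 1 else 0)" for A w
  define typical where "typical A \<xi> w = (if l2_dist m (obs A \<xi> (fst w)) (matvec m n A (fst w)) \<le> 2 * \<sigma>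
         \<and> l2_dist m (matvec m n A (fst w)) (matvec m n A (snd w)) \<le> 2 * \<sigma>
         \<and> l2_dist m (matvec m n A (fst w)) (matvec m n A x0) \<le> 2 * \<rho>
       then posterior_mass S A (obs A \<xi> (fst w)) else 0)" for A \<xi> w
  have [measurable]: "noisy \<in> borel_measurable (PiM {..<m} (\<lambda>_. borel))"
    unfolding noisy_def by measurable
  have expands_meas [measurable (raw)]: "(\<lambda>x. expands (f x) (g x)) \<in> borel_measurable M"
    if [measurable]: "f \<in> M \<rightarrow>\<^sub>M PiM ({..<m} \<times> {..<n}) (\<lambda>_. borel)"
      "g \<in> M \<rightarrow>\<^sub>M PiM {..<n} (\<lambda>_. borel) \<Otimes>\<^sub>M PiM {..<n} (\<lambda>_. borel)" for f g and M :: "'c measure"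
    unfolding expands_def by measurable
  have typical_meas [measurable (raw)]: "(\<lambda>x. typical (f x) (h x) (g x)) \<in> borel_measurable M"
    if [measurable]: "f \<in> M \<rightarrow>\<^sub>M PiM ({..<m} \<times> {..<n}) (\<lambda>_. borel)"
      "h \<in> M \<rightarrow>\<^sub>M PiM {..<m} (\<lambda>_. borel)"
      "g \<in> M \<rightarrow>\<^sub>M PiM {..<n} (\<lambda>_. borel) \<Otimes>\<^sub>M PiM {..<n} (\<lambda>_. borel)" for f g h and M :: "'d measure"
    unfolding typical_def by measurable
  \<comment> \<open>An exceptional event contributes at least 1, which dominates any posterior mass;
    if none occurs, \<open>typical\<close> equals the posterior mass.\<close>
  have le: "(if cell w then posterior_mass S A (obs A \<xi> (fst w)) else 0)
      \<le> (if cell w then noisy \<xi> + expands A w else 0) + typical A \<xi> w" for A \<xi> w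
  proof -
    have "posterior_mass S A (obs A \<xi> (fst w)) \<le> noisy \<xi> + expands A w + typical A \<xi> w"
    proof (cases "noisy \<xi> = 1 \<or> 1 \<le> expands A w")
      case True
      then have "1 \<le> noisy \<xi> + expands A w"
        by (metis add_increasing add_increasing2 order_refl zero_le)
      then have "1 \<le> noisy \<xi> + expands A w + typical A \<xi> w" by (simp add: add_increasing2)
      then show ?thesis using posterior_mass_le_1 order_trans by blast
    next
      case False
      then have "typical A \<xi> w = posterior_mass S A (obs A \<xi> (fst w))"
        by (auto simp: noisy_def expands_def typical_def l2_dist_measurement split: if_splits)
      then show ?thesis by simp
    qed
    then show ?thesis by simp
  qed
  have "(\<integral>\<^sup>+A. \<integral>\<^sup>+\<xi>. \<integral>\<^sup>+w. (if cell w then posterior_mass S A (obs A \<xi> (fst w)) else 0) \<partial>\<gamma> \<partial>N \<partial>G)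
      \<le> (\<integral>\<^sup>+A. \<integral>\<^sup>+\<xi>. \<integral>\<^sup>+w. (if cell w then noisy \<xi> + expands A w else 0) + typical A \<xi> w \<partial>\<gamma> \<partial>N \<partial>G)"
    by (intro nn_integral_mono le)
  \<comment> \<open>The noise is moved innermost, the order in which the change of measure is
    stated.\<close>
  also have "\<dots> = (\<integral>\<^sup>+A. \<integral>\<^sup>+w. \<integral>\<^sup>+\<xi>. (if cell w then noisy \<xi> + expands A w else 0) + typical A \<xi> w \<partial>N \<partial>\<gamma> \<partial>G)"
  proof (rule nn_integral_cong)
    fix A assume "A \<in> space G"
    then have [measurable]: "A \<in> space (PiM ({..<m} \<times> {..<n}) (\<lambda>_. borel))"
      using sets_eq_imp_space_eq[OF sets_gaussian_matrix] by auto
    show "(\<integral>\<^sup>+\<xi>. \<integral>\<^sup>+w. (if cell w then noisy \<xi> + expands A w else 0) + typical A \<xi> w \<partial>\<gamma> \<partial>N)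
        = (\<integral>\<^sup>+w. \<integral>\<^sup>+\<xi>. (if cell w then noisy \<xi> + expands A w else 0) + typical A \<xi> w \<partial>N \<partial>\<gamma>)"
      by (rule N\<gamma>.Fubini'[symmetric]) measurable
  qed
  also have "\<dots> = (\<integral>\<^sup>+A. \<integral>\<^sup>+w. (\<integral>\<^sup>+\<xi>. (if cell w then noisy \<xi> + expands A w else 0) \<partial>N)
      + (\<integral>\<^sup>+\<xi>. typical A \<xi> w \<partial>N) \<partial>\<gamma> \<partial>G)"
  proof (intro nn_integral_cong nn_integral_add)
    fix A w assume "A \<in> space G" and w: "w \<in> space \<gamma>"
    then have [measurable]: "A \<in> space (PiM ({..<m} \<times> {..<n}) (\<lambda>_. borel))"
      using sets_eq_imp_space_eq[OF sets_gaussian_matrix] by auto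
    have [measurable]: "w \<in> space (PiM {..<n} (\<lambda>_. borel) \<Otimes>\<^sub>M PiM {..<n} (\<lambda>_. borel))"
      using w unfolding sets_eq_imp_space_eq[OF sets_\<gamma>] .
    show "(\<lambda>\<xi>. (if cell w then noisy \<xi> + expands A w else 0)) \<in> borel_measurable N"
      by measurable
    show "(\<lambda>\<xi>. typical A \<xi> w) \<in> borel_measurable N"
      by measurable
  qed
  also have "\<dots> = (\<integral>\<^sup>+A. (\<integral>\<^sup>+w. \<integral>\<^sup>+\<xi>. (if cell w then noisy \<xi> + expands A w else 0) \<partial>N \<partial>\<gamma>)
      + (\<integral>\<^sup>+w. \<integral>\<^sup>+\<xi>. typical A \<xi> w \<partial>N \<partial>\<gamma>) \<partial>G)"
  proof (intro nn_integral_cong nn_integral_add)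
    fix A assume "A \<in> space G"
    then have [measurable]: "A \<in> space (PiM ({..<m} \<times> {..<n}) (\<lambda>_. borel))"
      using sets_eq_imp_space_eq[OF sets_gaussian_matrix] by auto
    show "(\<lambda>w. \<integral>\<^sup>+\<xi>. (if cell w then noisy \<xi> + expands A w else 0) \<partial>N) \<in> borel_measurable \<gamma>"
      by measurable
    show "(\<lambda>w. \<integral>\<^sup>+\<xi>. typical A \<xi> w \<partial>N) \<in> borel_measurable \<gamma>"
      by measurable
  qed
  also have "\<dots> = (\<integral>\<^sup>+A. \<integral>\<^sup>+w. \<integral>\<^sup>+\<xi>. (if cell w then noisy \<xi> + expands A w else 0) \<partial>N \<partial>\<gamma> \<partial>G)
      + (\<integral>\<^sup>+A. \<integral>\<^sup>+w. \<integral>\<^sup>+\<xi>. typical A \<xi> w \<partial>N \<partial>\<gamma> \<partial>G)"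
    by (intro nn_integral_add) measurable
  also have "\<dots> \<le> ennreal (3 * exp (- (real m / 2))) + ennreal (2 * exp (- (real m / 2)))"
  proof (intro add_mono)
    \<comment> \<open>The tail bounds hold for fixed vectors, so the coupling is integrated last;
      inside a cell the distances to be expanded are at most \<open>\<sigma>\<close> and
      \<open>\<rho>\<close>.\<close>
    have "(\<integral>\<^sup>+A. \<integral>\<^sup>+w. \<integral>\<^sup>+\<xi>. (if cell w then noisy \<xi> + expands A w else 0) \<partial>N \<partial>\<gamma> \<partial>G)
        = (\<integral>\<^sup>+w. \<integral>\<^sup>+A. \<integral>\<^sup>+\<xi>. (if cell w then noisy \<xi> + expands A w else 0) \<partial>N \<partial>G \<partial>\<gamma>)"
      by (rule G\<gamma>.Fubini'[symmetric]) measurable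
    also have "\<dots> \<le> (\<integral>\<^sup>+w. ennreal (3 * exp (- (real m / 2))) \<partial>\<gamma>)"
    proof (intro nn_integral_mono)
      fix w assume w: "w \<in> space \<gamma>"
      have [measurable]: "w \<in> space (PiM {..<n} (\<lambda>_. borel) \<Otimes>\<^sub>M PiM {..<n} (\<lambda>_. borel))"
        using w unfolding sets_eq_imp_space_eq[OF sets_\<gamma>] .
      have [measurable]: "fst w \<in> space (PiM {..<n} (\<lambda>_. borel))" "snd w \<in> space (PiM {..<n} (\<lambda>_. borel))"
        using space_\<gamma>[OF w] by (simp_all add: Rn_def)
      show "(\<integral>\<^sup>+A. \<integral>\<^sup>+\<xi>. (if cell w then noisy \<xi> + expands A w else 0) \<partial>N \<partial>G) \<le> ennreal (3 * exp (- (real m / 2)))"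
      proof (cases "cell w")
        case True
        have "(\<integral>\<^sup>+A. \<integral>\<^sup>+\<xi>. (if cell w then noisy \<xi> + expands A w else 0) \<partial>N \<partial>G)
            = (\<integral>\<^sup>+\<xi>. noisy \<xi> \<partial>N) + (\<integral>\<^sup>+A. expands A w \<partial>G)"
          using True by (simp add: nn_integral_matrix_noise_add)
        also have "(\<integral>\<^sup>+A. expands A w \<partial>G)
            = (\<integral>\<^sup>+A. (if 2 * \<sigma> < l2_dist m (matvec m n A (fst w)) (matvec m n A (snd w)) then 1 else 0) \<partial>G)
            + (\<integral>\<^sup>+A. (if 2 * \<rho> < l2_dist m (matvec m n A (fst w)) (matvec m n A x0) then 1 else 0) \<partial>G)"
          unfolding expands_def by (rule nn_integral_add) measurable
        also have "(\<integral>\<^sup>+\<xi>. noisy \<xi> \<partial>N) + \<dots> = emeasure N {\<xi> \<in> space N. 2 * \<sigma> < L2_set \<xi> {..<m}}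
            + (emeasure G {A \<in> space G. 2 * \<sigma> < l2_dist m (matvec m n A (fst w)) (matvec m n A (snd w))}
            + emeasure G {A \<in> space G. 2 * \<rho> < l2_dist m (matvec m n A (fst w)) (matvec m n A x0)})"
          unfolding noisy_def by (subst (1 2 3) nn_integral_if_eq_emeasure) measurable
        \<comment> \<open>All three bounds use \<open>K = 2\<close>, for which
          \<open>1/2 - K^2/4 = - 1/2\<close>.\<close>
        also have "\<dots> \<le> ennreal (exp (real m * (1 / 2 - 2\<^sup>2 / 4)))
            + (ennreal (exp (real m * (1 / 2 - 2\<^sup>2 / 4))) + ennreal (exp (real m * (1 / 2 - 2\<^sup>2 / 4))))"
          using m \<sigma> \<rho> True x0 space_\<gamma>[OF w]
          by (intro add_mono emeasure_gaussian_noise_large emeasure_gaussian_matrix_expands)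
            (auto simp: cell_def l2_dist_commute)
        also have "\<dots> = ennreal (3 * exp (- (real m / 2)))"
          by (simp add: ennreal_plus[symmetric] del: ennreal_plus)
        finally show ?thesis .
      qed simp
    qed
    also have "\<dots> = ennreal (3 * exp (- (real m / 2)))" by (simp add: \<gamma>.emeasure_space_1)
    finally show "(\<integral>\<^sup>+A. \<integral>\<^sup>+w. \<integral>\<^sup>+\<xi>. (if cell w then noisy \<xi> + expands A w else 0) \<partial>N \<partial>\<gamma> \<partial>G)
      \<le> ennreal (3 * exp (- (real m / 2)))" .
  next
    have "(\<integral>\<^sup>+A. \<integral>\<^sup>+w. \<integral>\<^sup>+\<xi>. typical A \<xi> w \<partial>N \<partial>\<gamma> \<partial>G)
        \<le> (\<integral>\<^sup>+A. ennreal (exp (8 * real m)) * (\<integral>\<^sup>+x. indicator S x *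
          (\<integral>\<^sup>+\<xi>. (if l2_dist m (obs A \<xi> x) (matvec m n A x0) \<le> 4 * \<rho> then 1 else 0) \<partial>N) \<partial>P) \<partial>G)"
      unfolding typical_def
      by (intro nn_integral_mono nn_integral_couple_posterior_mass_le[OF \<gamma> snd S' _ x0 \<rho>])
    also have "\<dots> = ennreal (exp (8 * real m)) * (\<integral>\<^sup>+A. \<integral>\<^sup>+x. indicator S x *
          (\<integral>\<^sup>+\<xi>. (if l2_dist m (obs A \<xi> x) (matvec m n A x0) \<le> 4 * \<rho> then 1 else 0) \<partial>N) \<partial>P \<partial>G)"
    proof (rule nn_integral_cmult)
      have [measurable]: "S \<in> sets (PiM {..<n} (\<lambda>_. borel))" using S' by (simp add: sets_Rn)
      show "(\<lambda>A. \<integral>\<^sup>+x. indicator S x *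
          (\<integral>\<^sup>+\<xi>. (if l2_dist m (obs A \<xi> x) (matvec m n A x0) \<le> 4 * \<rho> then 1 else 0) \<partial>N) \<partial>P) \<in> borel_measurable G"
        by measurable
    qed
    also have "\<dots> \<le> ennreal (exp (8 * real m)) * ennreal (2 * exp (real m * (- 17 / 2)))"
      by (intro mult_left_mono nn_integral_far_observed_near_le x0 \<rho> S) simp
    also have "\<dots> = ennreal (2 * exp (- (real m / 2)))"
      by (simp add: ennreal_mult'[symmetric] exp_add[symmetric])
    finally show "(\<integral>\<^sup>+A. \<integral>\<^sup>+w. \<integral>\<^sup>+\<xi>. typical A \<xi> w \<partial>N \<partial>\<gamma> \<partial>G) \<le> ennreal (2 * exp (- (real m / 2)))" .
  qed
  also have "\<dots> = ennreal (5 * exp (- (real m / 2)))"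
    by (simp add: ennreal_plus[symmetric] del: ennreal_plus)
  finally show ?thesis unfolding cell_def .
qed

end

section \<open>Couplings, coverings and the law of the sample\<close>

lemma Cov_obtain:
  assumes m: "ereal (real m) \<ge> ereal 4 * ln_enat (Cov n \<eta> \<delta> Q)" and \<delta>: "\<delta> < 1"
  obtains k x where "real k \<le> exp (real m / 4)" "\<And>i. i < k \<Longrightarrow> x i \<in> space (Rn n)"
    "1 - \<delta> \<le> measure Q (\<Union>i<k. l2_ball n (x i) \<eta>)"
proof -
  define K where "K = {enat k | k. \<exists>x. (\<forall>i<k. x i \<in> space (Rn n)) \<and>
     measure Q (\<Union>i<k. l2_ball n (x i) \<eta>) \<ge> 1 - \<delta>}"
  have Cov: "Cov n \<eta> \<delta> Q = Inf K" by (simp add: Cov_def K_def)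
  \<comment> \<open>If no finite covering existed, \<open>Cov\<close> and its logarithm would be
    infinite, contradicting the bound by \<open>m\<close>.\<close>
  have "K \<noteq> {}"
  proof
    assume "K = {}"
    then have "Cov n \<eta> \<delta> Q = \<infinity>" by (simp add: Cov Inf_enat_def)
    then show False using m by simp
  qed
  then have "Inf K \<in> K" unfolding Inf_enat_def by (auto intro: LeastI)
  then obtain k x where k: "Inf K = enat k" and x: "\<forall>i<k. x i \<in> space (Rn n)"
      "1 - \<delta> \<le> measure Q (\<Union>i<k. l2_ball n (x i) \<eta>)"
    by (auto simp: K_def)
  \<comment> \<open>An empty union has measure 0, which is below \<open>1 - \<delta>\<close>. This
    excludes the value \<open>-\<infinity>\<close> of \<open>ln_enat\<close>.\<close>
  have "k \<noteq> 0" using x(2) \<delta> by (intro notI) simp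
  then have "4 * ln (real k) \<le> real m" using m by (simp add: Cov k)
  then have "ln (real k) \<le> real m / 4" by simp
  then have "exp (ln (real k)) \<le> exp (real m / 4)" by simp
  then have "real k \<le> exp (real m / 4)" using \<open>k \<noteq> 0\<close> by simp
  then show thesis using x that by blast
qed

text \<open>Markov's inequality for the \<open>p\<close>-th power of the distance at level
  \<open>a = 2 * \<epsilon> / \<delta> powr (1 / p)\<close>: a coupling of cost below
  \<open>2 * \<epsilon>\<close> gives
  \<open>(2 * \<epsilon>) powr p / a powr p = \<delta>\<close>.\<close>

lemma wasserstein_coupling_far_le:
  assumes W: "wasserstein n p R P \<le> ennreal \<epsilon>" and \<epsilon>: "0 < \<epsilon>" and p: "1 \<le> p" and \<delta>: "0 < \<delta>"
    and \<sigma>: "2 * (\<epsilon> / \<delta> powr (1 / p)) \<le> \<sigma>"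
  obtains \<gamma> where "\<gamma> \<in> couplings n R P"
    "emeasure \<gamma> {w \<in> space \<gamma>. \<sigma> < l2_dist n (fst w) (snd w)} \<le> ennreal \<delta>"
proof -
  \<comment> \<open>The infimum over couplings is not shown to be attained, so some room above
    \<open>\<epsilon>\<close> is taken; the factor 2 reappears in the lower bound on
    \<open>\<sigma>\<close>.\<close>
  have "wasserstein n p R P < ennreal (2 * \<epsilon>)"
    using W by (rule order_le_less_trans) (use \<epsilon> in \<open>simp add: ennreal_lessI\<close>)
  then obtain \<gamma> where \<gamma>: "\<gamma> \<in> couplings n R P"
    and lt: "ennpowr (\<integral>\<^sup>+(u, v). ennreal (l2_dist n u v powr p) \<partial>\<gamma>) (1 / p) < ennreal (2 * \<epsilon>)"
    unfolding wasserstein_def INF_less_iff by blast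
  define I where "I = (\<integral>\<^sup>+w. ennreal (l2_dist n (fst w) (snd w) powr p) \<partial>\<gamma>)"
  have lt: "ennpowr I (1 / p) < ennreal (2 * \<epsilon>)" using lt by (simp add: I_def case_prod_beta')
  have fin: "I \<noteq> \<infinity>" using lt by (auto simp: ennpowr_def)
  then have "enn2real I powr (1 / p) < 2 * \<epsilon>"
    using lt \<epsilon> by (simp add: ennpowr_def ennreal_less_iff)
  then have "(enn2real I powr (1 / p)) powr p \<le> (2 * \<epsilon>) powr p"
    using p by (intro powr_mono2) auto
  then have "enn2real I \<le> (2 * \<epsilon>) powr p"
    using p by (simp add: powr_powr)
  then have I: "I \<le> ennreal ((2 * \<epsilon>) powr p)"
    using fin by (metis ennreal_enn2real ennreal_leI infinity_ennreal_def less_top)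
  have sets_\<gamma>[measurable_cong]: "sets \<gamma> = sets (PiM {..<n} (\<lambda>_. borel) \<Otimes>\<^sub>M PiM {..<n} (\<lambda>_. borel))"
    using \<gamma> by (simp add: couplings_def space_prob_algebra Rn_def)
  define a where "a = 2 * (\<epsilon> / \<delta> powr (1 / p))"
  have a: "0 < a" "a \<le> \<sigma>" using \<epsilon> \<delta> \<sigma> by (auto simp: a_def)
  have ap: "a powr p = (2 * \<epsilon>) powr p / \<delta>"
    using p \<epsilon> \<delta> by (simp add: a_def powr_divide powr_mult powr_powr)
  have "emeasure \<gamma> {w \<in> space \<gamma>. \<sigma> < l2_dist n (fst w) (snd w)}
      = (\<integral>\<^sup>+w. indicator {w \<in> space \<gamma>. \<sigma> < l2_dist n (fst w) (snd w)} w \<partial>\<gamma>)"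
    by (rule nn_integral_indicator[symmetric]) measurable
  also have "\<dots> \<le> (\<integral>\<^sup>+w. ennreal (1 / a powr p) * ennreal (l2_dist n (fst w) (snd w) powr p) \<partial>\<gamma>)"
  proof (intro nn_integral_mono)
    fix w
    have "1 \<le> 1 / a powr p * l2_dist n (fst w) (snd w) powr p" if "\<sigma> < l2_dist n (fst w) (snd w)"
    proof -
      have "a powr p \<le> l2_dist n (fst w) (snd w) powr p" using that a p by (intro powr_mono2) auto
      then show ?thesis using a by (simp add: field_simps)
    qed
    then show "indicator {w \<in> space \<gamma>. \<sigma> < l2_dist n (fst w) (snd w)} w
        \<le> ennreal (1 / a powr p) * ennreal (l2_dist n (fst w) (snd w) powr p)"
      by (simp add: indicator_def ennreal_mult'[symmetric])
  qed
  also have "\<dots> = ennreal (1 / a powr p) * I"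
    unfolding I_def by (rule nn_integral_cmult) measurable
  also have "\<dots> \<le> ennreal (1 / a powr p) * ennreal ((2 * \<epsilon>) powr p)"
    by (rule mult_left_mono[OF I]) simp
  also have "\<dots> = ennreal \<delta>"
    using \<epsilon> \<delta> by (simp add: ap ennreal_mult'[symmetric])
  finally show thesis using \<gamma> that by blast
qed

section \<open>The sampling law for fixed matrix and noise\<close>

context posterior_sampling
begin

lemma posterior_mass_mono: "S \<subseteq> T \<Longrightarrow> posterior_mass S A y \<le> posterior_mass T A y"
  unfolding posterior_mass_def
  by (intro divide_right_mono_ennreal nn_integral_mono) (auto simp: indicator_def)

lemma emeasure_posterior:
  assumes A: "A \<in> space G" and y: "y \<in> space (PiM {..<m} (\<lambda>_. borel))" and S: "S \<in> sets (Rn n)"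
  shows "emeasure (posterior m n \<sigma> P y A) S = posterior_mass S A y"
proof -
  have [measurable]: "A \<in> space (PiM ({..<m} \<times> {..<n}) (\<lambda>_. borel))" "y \<in> space (PiM {..<m} (\<lambda>_. borel))"
    using A y sets_eq_imp_space_eq[OF sets_gaussian_matrix] by auto
  have [measurable]: "S \<in> sets P" using S by (simp add: sets_P sets_Rn)
  have "emeasure (posterior m n \<sigma> P y A) S
      = (\<integral>\<^sup>+x. ennreal (lik A y x) / evidence A y * indicator S x \<partial>P)"
    unfolding posterior_def evidence_def[symmetric] by (rule emeasure_density) measurable
  also have "\<dots> = (\<integral>\<^sup>+x. ennreal (lik A y x) * indicator S x / evidence A y \<partial>P)"
    by (simp add: divide_ennreal_def mult_ac)
  also have "\<dots> = posterior_mass S A y"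
    unfolding posterior_mass_def by (rule nn_integral_divide) measurable
  finally show ?thesis .
qed

lemma sets_posterior: "sets (posterior m n \<sigma> P y A) = sets (Rn n)"
  by (simp add: posterior_def sets_P sets_Rn)

lemma prob_space_posterior:
  assumes A: "A \<in> space G" and y: "y \<in> space (PiM {..<m} (\<lambda>_. borel))"
  shows "prob_space (posterior m n \<sigma> P y A)"
proof (rule prob_spaceI)
  have 1: "evidence A y < top" using evidence_le_1[of A y] by (rule order_le_less_trans) simp
  have "(\<integral>\<^sup>+x. ennreal (lik A y x) * indicator (space (Rn n)) x \<partial>P) = evidence A y"
    unfolding evidence_def by (intro nn_integral_cong) (simp add: space_P)
  then have "posterior_mass (space (Rn n)) A y = 1"
    using evidence_pos[OF A y] 1 by (simp add: posterior_mass_def ennreal_divide_self)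
  then show "emeasure (posterior m n \<sigma> P y A) (space (posterior m n \<sigma> P y A)) = 1"
    using emeasure_posterior[OF A y, of "space (Rn n)"] by (simp add: posterior_def space_P)
qed

lemma obs_in_space: "obs A \<xi> x \<in> space (PiM {..<m} (\<lambda>_. borel))"
  by (simp add: measurement_def space_PiM)

text \<open>The formulas for \<open>bind\<close> require a measurable kernel into probability
  measures; it suffices that the posterior mass of each measurable set is measurable in
  \<open>x\<close>.\<close>

lemma measurable_posterior:
  assumes A: "A \<in> space G" and \<xi>: "\<xi> \<in> space N"
  shows "(\<lambda>x. posterior m n \<sigma> P (obs A \<xi> x) A) \<in> Rn n \<rightarrow>\<^sub>M prob_algebra (Rn n)"
proof (intro measurable_prob_algebraI measurable_subprob_algebra)
  have [measurable]: "A \<in> space (PiM ({..<m} \<times> {..<n}) (\<lambda>_. borel))" "\<xi> \<in> space (PiM {..<m} (\<lambda>_. borel))"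
    using A \<xi> sets_eq_imp_space_eq[OF sets_gaussian_matrix] sets_eq_imp_space_eq[OF sets_gaussian_noise] by auto
  fix S assume S[measurable]: "S \<in> sets (Rn n)"
  show "(\<lambda>x. emeasure (posterior m n \<sigma> P (obs A \<xi> x) A) S) \<in> borel_measurable (Rn n)"
    unfolding emeasure_posterior[OF A obs_in_space S] by measurable
qed (simp_all add: prob_space_posterior[OF A obs_in_space] prob_space_imp_subprob_space sets_posterior)

lemma measurable_sampling_kernel:
  assumes A: "A \<in> space G" and \<xi>: "\<xi> \<in> space N"
  shows "(\<lambda>x. posterior m n \<sigma> P (obs A \<xi> x) A \<bind> (\<lambda>xhat. return (Rn n \<Otimes>\<^sub>M Rn n) (x, xhat)))
    \<in> Rn n \<rightarrow>\<^sub>M prob_algebra (Rn n \<Otimes>\<^sub>M Rn n)"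
proof (rule measurable_bind_prob_space2[OF measurable_posterior[OF A \<xi>]])
  have "(\<lambda>(x, y). return (Rn n \<Otimes>\<^sub>M Rn n) (x, y)) = return (Rn n \<Otimes>\<^sub>M Rn n)" by auto
  then show "(\<lambda>(x, y). return (Rn n \<Otimes>\<^sub>M Rn n) (x, y)) \<in> Rn n \<Otimes>\<^sub>M Rn n \<rightarrow>\<^sub>M prob_algebra (Rn n \<Otimes>\<^sub>M Rn n)"
    by (simp add: measurable_return_prob_space)
qed

lemma prob_space_sampling_law:
  assumes "A \<in> space G" "\<xi> \<in> space N" "R \<in> space (prob_algebra (Rn n))"
  shows "prob_space (sampling_law m n \<sigma> R P A \<xi>)"
  unfolding sampling_law_def by (rule prob_space_bind'[OF assms(3) measurable_sampling_kernel[OF assms(1,2)]])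

text \<open>Unfolds both binds into one integral over the true signal: once that signal is fixed,
  the event about pairs becomes its section, an event about the sample.\<close>

lemma emeasure_sampling_law:
  assumes A: "A \<in> space G" and \<xi>: "\<xi> \<in> space N" and R: "R \<in> space (prob_algebra (Rn n))"
    and E[measurable]: "E \<in> sets (Rn n \<Otimes>\<^sub>M Rn n)"
  shows "emeasure (sampling_law m n \<sigma> R P A \<xi>) E = (\<integral>\<^sup>+x. posterior_mass (Pair x -` E) A (obs A \<xi> x) \<partial>R)"
proof -
  have space_R: "space R = space (Rn n)"
    using R by (intro sets_eq_imp_space_eq) (simp add: space_prob_algebra)
  have "emeasure (sampling_law m n \<sigma> R P A \<xi>) E
      = (\<integral>\<^sup>+x. emeasure (posterior m n \<sigma> P (obs A \<xi> x) A \<bind> (\<lambda>xhat. return (Rn n \<Otimes>\<^sub>M Rn n) (x, xhat))) E \<partial>R)"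
    unfolding sampling_law_def by (rule emeasure_bind_prob_algebra[OF R measurable_sampling_kernel[OF A \<xi>] E])
  also have "\<dots> = (\<integral>\<^sup>+x. posterior_mass (Pair x -` E) A (obs A \<xi> x) \<partial>R)"
  proof (rule nn_integral_cong)
    fix x assume "x \<in> space R"
    then have x[measurable]: "x \<in> space (Rn n)" by (simp add: space_R)
    have Q: "posterior m n \<sigma> P (obs A \<xi> x) A \<in> space (prob_algebra (Rn n))"
      using measurable_space[OF measurable_posterior[OF A \<xi>] x] .
    then have sets_Q[measurable_cong]: "sets (posterior m n \<sigma> P (obs A \<xi> x) A) = sets (Rn n)"
      by (simp add: space_prob_algebra)
    have sec: "Pair x -` E \<in> sets (Rn n)" by (rule sets_Pair1[OF E])
    have "emeasure (posterior m n \<sigma> P (obs A \<xi> x) A \<bind> (\<lambda>xhat. return (Rn n \<Otimes>\<^sub>M Rn n) (x, xhat))) E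
        = (\<integral>\<^sup>+xhat. emeasure (return (Rn n \<Otimes>\<^sub>M Rn n) (x, xhat)) E \<partial>posterior m n \<sigma> P (obs A \<xi> x) A)"
    proof (rule emeasure_bind_prob_algebra[OF Q _ E])
      show "(\<lambda>xhat. return (Rn n \<Otimes>\<^sub>M Rn n) (x, xhat)) \<in> Rn n \<rightarrow>\<^sub>M prob_algebra (Rn n \<Otimes>\<^sub>M Rn n)"
        by (rule measurable_compose[OF measurable_Pair1' [OF x] measurable_return_prob_space])
    qed
    also have "\<dots> = (\<integral>\<^sup>+xhat. indicator (Pair x -` E) xhat \<partial>posterior m n \<sigma> P (obs A \<xi> x) A)"
      by (simp add: indicator_def)
    also have "\<dots> = posterior_mass (Pair x -` E) A (obs A \<xi> x)"
      using sec by (simp add: sets_Q emeasure_posterior[OF A obs_in_space sec])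
    finally show "emeasure (posterior m n \<sigma> P (obs A \<xi> x) A \<bind> (\<lambda>xhat. return (Rn n \<Otimes>\<^sub>M Rn n) (x, xhat))) E
        = posterior_mass (Pair x -` E) A (obs A \<xi> x)" .
  qed
  finally show ?thesis .
qed

end

lemma sets_l2_ball:
  assumes "x \<in> space (Rn n)"
  shows "l2_ball n x r \<in> sets (Rn n)"
proof -
  have [measurable]: "x \<in> space (PiM {..<n} (\<lambda>_. borel))" using assms by (simp add: Rn_def)
  show ?thesis unfolding l2_ball_def by measurable
qed

lemma emeasure_outside_le:
  assumes \<gamma>: "prob_space \<gamma>" and f: "f \<in> \<gamma> \<rightarrow>\<^sub>M M" and U: "U \<in> sets M"
    and Q: "distr \<gamma> M f = Q" and \<delta>: "1 - \<delta> \<le> measure Q U"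
  shows "emeasure \<gamma> {w \<in> space \<gamma>. f w \<notin> U} \<le> ennreal \<delta>"
proof -
  interpret prob_space \<gamma> by fact
  have S: "f -` U \<inter> space \<gamma> \<in> events" using f U by (rule measurable_sets)
  have "{w \<in> space \<gamma>. f w \<notin> U} = space \<gamma> - (f -` U \<inter> space \<gamma>)" by auto
  then have "prob {w \<in> space \<gamma>. f w \<notin> U} = 1 - prob (f -` U \<inter> space \<gamma>)"
    using prob_compl[OF S] by simp
  also have "prob (f -` U \<inter> space \<gamma>) = measure Q U"
    unfolding Q[symmetric] using f U by (simp add: measure_distr)
  finally show ?thesis using \<delta> by (simp add: emeasure_eq_measure ennreal_leI)
qed

text \<open>The covering may belong to either marginal. If it covers \<open>P\<close>, the centre is
  close to \<open>snd w\<close>, and the coupling distance \<open>\<sigma>\<close> carries it to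
  \<open>fst w\<close>; hence the radius \<open>\<eta> + \<sigma>\<close> and the minimum of the two
  covering numbers in the theorem. A union bound adds \<open>\<delta>\<close> for a distant pair and
  \<open>\<delta>\<close> for an uncovered point.\<close>

lemma coupling_covered:
  fixes x :: "nat \<Rightarrow> nat \<Rightarrow> real"
  assumes \<gamma>: "\<gamma> \<in> couplings n R P"
    and far: "emeasure \<gamma> {w \<in> space \<gamma>. \<sigma> < l2_dist n (fst w) (snd w)} \<le> ennreal \<delta>"
    and \<sigma>: "0 \<le> \<sigma>" and \<delta>: "0 \<le> \<delta>" and x: "\<And>i. i < k \<Longrightarrow> x i \<in> space (Rn n)"
    and Q: "Q = R \<or> Q = P" and cov: "1 - \<delta> \<le> measure Q (\<Union>i<k. l2_ball n (x i) \<eta>)"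
  shows "emeasure \<gamma> {w \<in> space \<gamma>. \<not> (\<exists>i<k. l2_dist n (fst w) (snd w) \<le> \<sigma> \<and> l2_dist n (x i) (fst w) \<le> \<eta> + \<sigma>)}
    \<le> ennreal (2 * \<delta>)"
proof -
  have prob: "prob_space \<gamma>" and sets_\<gamma>: "sets \<gamma> = sets (Rn n \<Otimes>\<^sub>M Rn n)"
    and fst: "distr \<gamma> (Rn n) fst = R" and snd: "distr \<gamma> (Rn n) snd = P"
    using \<gamma> by (auto simp: couplings_def space_prob_algebra)
  have [measurable_cong]: "sets \<gamma> = sets (PiM {..<n} (\<lambda>_. borel) \<Otimes>\<^sub>M PiM {..<n} (\<lambda>_. borel))"
    using sets_\<gamma> by (simp add: Rn_def)
  have space_\<gamma>: "fst w \<in> space (Rn n)" "snd w \<in> space (Rn n)" if "w \<in> space \<gamma>" for w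
    using that unfolding sets_eq_imp_space_eq[OF sets_\<gamma>] by (simp_all add: space_pair_measure mem_Times_iff)
  define U where "U = (\<Union>i<k. l2_ball n (x i) \<eta>)"
  have U: "U \<in> sets (Rn n)" unfolding U_def using x by (intro sets.finite_UN sets_l2_ball) auto
  obtain f where f: "f = fst \<or> f = snd" "distr \<gamma> (Rn n) f = Q" using Q fst snd by blast
  have fm: "f \<in> \<gamma> \<rightarrow>\<^sub>M Rn n"
    using f(1) by (auto simp: measurable_cong_sets[OF sets_\<gamma> refl])
  have out: "emeasure \<gamma> {w \<in> space \<gamma>. f w \<notin> U} \<le> ennreal \<delta>"
    using emeasure_outside_le[OF prob fm U f(2)] cov by (simp add: U_def)
  have "\<exists>i<k. l2_dist n (x i) (fst w) \<le> \<eta> + \<sigma>"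
    if w: "l2_dist n (fst w) (snd w) \<le> \<sigma>" "f w \<in> U" for w
  proof -
    obtain i where i: "i < k" "l2_dist n (x i) (f w) \<le> \<eta>" using w(2) by (auto simp: U_def l2_ball_def)
    have "l2_dist n (x i) (fst w) \<le> \<eta> + \<sigma>"
      using f(1) i(2) w(1) \<sigma> l2_dist_triangle[of n "x i" "fst w" "snd w"] l2_dist_commute[of n "fst w" "snd w"]
      by auto
    then show ?thesis using i(1) by blast
  qed
  then have sub: "{w \<in> space \<gamma>. \<not> (\<exists>i<k. l2_dist n (fst w) (snd w) \<le> \<sigma> \<and> l2_dist n (x i) (fst w) \<le> \<eta> + \<sigma>)}
      \<subseteq> {w \<in> space \<gamma>. \<sigma> < l2_dist n (fst w) (snd w)} \<union> {w \<in> space \<gamma>. f w \<notin> U}"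
    by (smt (verit) Collect_mono_iff UnI1 UnI2 mem_Collect_eq subsetI)
  have "{w \<in> space \<gamma>. f w \<notin> U} = space \<gamma> - (f -` U \<inter> space \<gamma>)" by auto
  then have out_sets: "{w \<in> space \<gamma>. f w \<notin> U} \<in> sets \<gamma>" using measurable_sets[OF fm U] by auto
  have far_sets: "{w \<in> space \<gamma>. \<sigma> < l2_dist n (fst w) (snd w)} \<in> sets \<gamma>" by measurable
  have "emeasure \<gamma> {w \<in> space \<gamma>. \<not> (\<exists>i<k. l2_dist n (fst w) (snd w) \<le> \<sigma> \<and> l2_dist n (x i) (fst w) \<le> \<eta> + \<sigma>)}
      \<le> emeasure \<gamma> ({w \<in> space \<gamma>. \<sigma> < l2_dist n (fst w) (snd w)} \<union> {w \<in> space \<gamma>. f w \<notin> U})"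
    by (rule emeasure_mono[OF sub sets.Un[OF far_sets out_sets]])
  also have "\<dots> \<le> emeasure \<gamma> {w \<in> space \<gamma>. \<sigma> < l2_dist n (fst w) (snd w)} + emeasure \<gamma> {w \<in> space \<gamma>. f w \<notin> U}"
    by (rule emeasure_subadditive[OF far_sets out_sets])
  also have "\<dots> \<le> ennreal \<delta> + ennreal \<delta>" by (rule add_mono[OF far out])
  also have "\<dots> = ennreal (2 * \<delta>)" using \<delta> by (simp add: ennreal_plus[symmetric] del: ennreal_plus)
  finally show ?thesis .
qed

section \<open>Summing over the centres and concluding for random matrix and noise\<close>

context posterior_sampling
begin

abbreviation "far_pairs r \<equiv> {(x, xhat) \<in> space (Rn n \<Otimes>\<^sub>M Rn n). r \<le> l2_dist n x xhat}"

lemma sets_far_pairs: "far_pairs r \<in> sets (Rn n \<Otimes>\<^sub>M Rn n)"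
proof -
  have "far_pairs r = {w \<in> space (Rn n \<Otimes>\<^sub>M Rn n). r \<le> l2_dist n (fst w) (snd w)}" by auto
  also have "\<dots> \<in> sets (Rn n \<Otimes>\<^sub>M Rn n)" by measurable
  finally show ?thesis .
qed

text \<open>Here the set itself moves with the signal. Writing the indicator of the section as the
  indicator of \<open>E\<close> at a pair makes the integrand jointly measurable.\<close>

lemma measurable_posterior_mass_section:
  assumes [measurable]: "f \<in> M \<rightarrow>\<^sub>M PiM ({..<m} \<times> {..<n}) (\<lambda>_. borel)" "h \<in> M \<rightarrow>\<^sub>M PiM {..<m} (\<lambda>_. borel)"
    "g \<in> M \<rightarrow>\<^sub>M PiM {..<n} (\<lambda>_. borel)" and E: "E \<in> sets (Rn n \<Otimes>\<^sub>M Rn n)"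
  shows "(\<lambda>z. posterior_mass (Pair (g z) -` E) (f z) (h z)) \<in> borel_measurable M"
proof -
  have [measurable]: "E \<in> sets (PiM {..<n} (\<lambda>_. borel) \<Otimes>\<^sub>M PiM {..<n} (\<lambda>_. borel))"
    using E by (simp add: Rn_def)
  have "posterior_mass (Pair u -` E) A y
      = (\<integral>\<^sup>+x. ennreal (lik A y x) * indicator E (u, x) \<partial>P) / evidence A y" for u A y
    by (simp add: posterior_mass_def indicator_def)
  then show ?thesis by simp
qed

text \<open>In cell \<open>i\<close>, a sample at distance at least \<open>r\<close> from
  \<open>fst w\<close> is at distance at least \<open>r - \<rho>\<close>, hence at least
  \<open>d\<close>, from the centre \<open>x i\<close>. Pairs in no cell are charged the full mass
  1; this costs \<open>b\<close> whatever \<open>A\<close> and \<open>\<xi>\<close> are.\<close>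

lemma emeasure_sampling_law_far_le:
  fixes x :: "nat \<Rightarrow> nat \<Rightarrow> real"
  assumes A: "A \<in> space G" and \<xi>: "\<xi> \<in> space N" and R: "R \<in> space (prob_algebra (Rn n))"
    and \<gamma>: "\<gamma> \<in> couplings n R P"
    and covered: "emeasure \<gamma> {w \<in> space \<gamma>. \<not> (\<exists>i<k. l2_dist n (fst w) (snd w) \<le> \<sigma> \<and> l2_dist n (x i) (fst w) \<le> \<rho>)}
      \<le> ennreal b"
    and x: "\<And>i. i < k \<Longrightarrow> x i \<in> space (Rn n)" and r: "\<rho> + d \<le> r"
  shows "emeasure (sampling_law m n \<sigma> R P A \<xi>) (far_pairs r) \<le> ennreal b +
    (\<Sum>i<k. \<integral>\<^sup>+w. (if l2_dist n (fst w) (snd w) \<le> \<sigma> \<and> l2_dist n (x i) (fst w) \<le> \<rho>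
       then posterior_mass {z \<in> space (Rn n). d \<le> l2_dist n (x i) z} A (obs A \<xi> (fst w)) else 0) \<partial>\<gamma>)"
proof -
  have sets_\<gamma>: "sets \<gamma> = sets (Rn n \<Otimes>\<^sub>M Rn n)" and fst: "distr \<gamma> (Rn n) fst = R"
    using \<gamma> by (auto simp: couplings_def space_prob_algebra)
  have [measurable_cong]: "sets \<gamma> = sets (PiM {..<n} (\<lambda>_. borel) \<Otimes>\<^sub>M PiM {..<n} (\<lambda>_. borel))"
    using sets_\<gamma> by (simp add: Rn_def)
  have [measurable]: "A \<in> space (PiM ({..<m} \<times> {..<n}) (\<lambda>_. borel))" "\<xi> \<in> space (PiM {..<m} (\<lambda>_. borel))"
    using A \<xi> sets_eq_imp_space_eq[OF sets_gaussian_matrix] sets_eq_imp_space_eq[OF sets_gaussian_noise] by auto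
  have xm[measurable]: "x i \<in> space (PiM {..<n} (\<lambda>_. borel))" if "i < k" for i using x[OF that] by (simp add: Rn_def)
  have [measurable]: "{z \<in> space (Rn n). d \<le> l2_dist n (x i) z} \<in> sets (Rn n)" if [measurable]: "i < k" for i
    using xm[OF that] by measurable
  define cell where "cell i w \<longleftrightarrow> l2_dist n (fst w) (snd w) \<le> \<sigma> \<and> l2_dist n (x i) (fst w) \<le> \<rho>" for i w
  have cell_meas: "Measurable.pred \<gamma> (cell i)" if "i < k" for i
    using xm[OF that] unfolding cell_def by measurable
  define F where "F i w = (if cell i w
       then posterior_mass {z \<in> space (Rn n). d \<le> l2_dist n (x i) z} A (obs A \<xi> (fst w)) else 0)" for i w
  have F[measurable]: "F i \<in> borel_measurable \<gamma>" if i: "i < k" for i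
  proof -
    note [measurable] = cell_meas[OF i]
    show ?thesis unfolding F_def using i by measurable
  qed
  have unc: "{w \<in> space \<gamma>. \<not> (\<exists>i<k. cell i w)} \<in> sets \<gamma>"
  proof -
    have "{w \<in> space \<gamma>. cell i w} \<in> sets \<gamma>" if "i \<in> {..<k}" for i
      using cell_meas[of i] that by (simp add: pred_def)
    then have diff: "space \<gamma> - (\<Union>i\<in>{..<k}. {w \<in> space \<gamma>. cell i w}) \<in> sets \<gamma>"
      by (intro sets.Diff sets.top sets.finite_UN finite_lessThan)
    have eq: "space \<gamma> - (\<Union>i\<in>{..<k}. {w \<in> space \<gamma>. cell i w}) = {w \<in> space \<gamma>. \<not> (\<exists>i<k. cell i w)}"
      by (intro set_eqI) (simp add: Ball_def, metis)
    show ?thesis using diff unfolding eq .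
  qed
  have le: "posterior_mass (Pair (fst w) -` far_pairs r) A (obs A \<xi> (fst w))
      \<le> indicator {w \<in> space \<gamma>. \<not> (\<exists>i<k. cell i w)} w + (\<Sum>i<k. F i w)" if w: "w \<in> space \<gamma>" for w
  proof (cases "\<exists>i<k. cell i w")
    case True
    then obtain i where i: "i < k" "cell i w" by blast
    have "Pair (fst w) -` far_pairs r \<subseteq> {z \<in> space (Rn n). d \<le> l2_dist n (x i) z}"
    proof safe
      fix z assume z: "(fst w, z) \<in> space (Rn n \<Otimes>\<^sub>M Rn n)" "r \<le> l2_dist n (fst w) z"
      then show "z \<in> space (Rn n)" by (simp add: space_pair_measure)
      show "d \<le> l2_dist n (x i) z"
        using z(2) r i(2) l2_dist_triangle[of n "fst w" z "x i"] l2_dist_commute[of n "x i" "fst w"]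
        by (simp add: cell_def)
    qed
    then have "posterior_mass (Pair (fst w) -` far_pairs r) A (obs A \<xi> (fst w)) \<le> F i w"
      using i(2) by (simp add: F_def posterior_mass_mono)
    also have "\<dots> \<le> (\<Sum>i<k. F i w)" using i(1) by (intro member_le_sum) auto
    finally show ?thesis by (simp add: add_increasing)
  next
    case False
    then have "1 \<le> indicator {w \<in> space \<gamma>. \<not> (\<exists>i<k. cell i w)} w + (\<Sum>i<k. F i w)"
      using w by (simp add: add_increasing2)
    then show ?thesis using posterior_mass_le_1 order_trans by blast
  qed
  have pm: "(\<lambda>x. posterior_mass (Pair x -` far_pairs r) A (obs A \<xi> x)) \<in> borel_measurable (Rn n)"
    by (rule measurable_posterior_mass_section[OF _ _ _ sets_far_pairs]) measurable
  have "emeasure (sampling_law m n \<sigma> R P A \<xi>) (far_pairs r)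
      = (\<integral>\<^sup>+x. posterior_mass (Pair x -` far_pairs r) A (obs A \<xi> x) \<partial>distr \<gamma> (Rn n) fst)"
    unfolding fst by (rule emeasure_sampling_law[OF A \<xi> R sets_far_pairs])
  also have "\<dots> = (\<integral>\<^sup>+w. posterior_mass (Pair (fst w) -` far_pairs r) A (obs A \<xi> (fst w)) \<partial>\<gamma>)"
    using pm by (intro nn_integral_distr) (simp_all add: measurable_cong_sets[OF sets_\<gamma> refl])
  also have "\<dots> \<le> (\<integral>\<^sup>+w. indicator {w \<in> space \<gamma>. \<not> (\<exists>i<k. cell i w)} w + (\<Sum>i<k. F i w) \<partial>\<gamma>)"
    by (intro nn_integral_mono le)
  also have "\<dots> = emeasure \<gamma> {w \<in> space \<gamma>. \<not> (\<exists>i<k. cell i w)} + (\<Sum>i<k. \<integral>\<^sup>+w. F i w \<partial>\<gamma>)"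
  proof -
    have "(\<integral>\<^sup>+w. indicator {w \<in> space \<gamma>. \<not> (\<exists>i<k. cell i w)} w + (\<Sum>i<k. F i w) \<partial>\<gamma>)
        = (\<integral>\<^sup>+w. indicator {w \<in> space \<gamma>. \<not> (\<exists>i<k. cell i w)} w \<partial>\<gamma>) + (\<integral>\<^sup>+w. (\<Sum>i<k. F i w) \<partial>\<gamma>)"
      by (rule nn_integral_add[OF borel_measurable_indicator[OF unc] borel_measurable_sum]) (rule F, simp)
    also have "(\<integral>\<^sup>+w. (\<Sum>i<k. F i w) \<partial>\<gamma>) = (\<Sum>i<k. \<integral>\<^sup>+w. F i w \<partial>\<gamma>)"
      by (rule nn_integral_sum) (rule F, simp)
    finally show ?thesis unfolding nn_integral_indicator[OF unc] .
  qed
  also have "\<dots> \<le> ennreal b + (\<Sum>i<k. \<integral>\<^sup>+w. F i w \<partial>\<gamma>)"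
    using covered by (intro add_right_mono) (simp add: cell_def)
  finally show ?thesis unfolding F_def cell_def .
qed

text \<open>At most \<open>exp (m / 4)\<close> centres contribute \<open>5 exp (- m / 2)\<close>
  each. Joint measurability is included because Markov's inequality is applied to this sum as a
  function of \<open>(A, \<xi>)\<close>.\<close>

lemma expected_cells_le:
  fixes x :: "nat \<Rightarrow> nat \<Rightarrow> real"
  assumes \<gamma>: "\<gamma> \<in> couplings n R P" and x: "\<And>i. i < k \<Longrightarrow> x i \<in> space (Rn n)" and \<rho>: "\<sigma> \<le> \<rho>"
    and k: "real k \<le> exp (real m / 4)"
  defines "F \<equiv> \<lambda>A \<xi> i. \<integral>\<^sup>+w. (if l2_dist n (fst w) (snd w) \<le> \<sigma> \<and> l2_dist n (x i) (fst w) \<le> \<rho>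
       then posterior_mass {z \<in> space (Rn n). 10 * exp 9 * \<rho> \<le> l2_dist n (x i) z} A (obs A \<xi> (fst w)) else 0) \<partial>\<gamma>"
  shows "(\<lambda>(A, \<xi>). \<Sum>i<k. F A \<xi> i) \<in> borel_measurable (G \<Otimes>\<^sub>M N)"
    and "(\<integral>\<^sup>+(A, \<xi>). (\<Sum>i<k. F A \<xi> i) \<partial>(G \<Otimes>\<^sub>M N)) \<le> ennreal (5 * exp (- (real m / 4)))"
proof -
  have \<gamma>p: "\<gamma> \<in> space (prob_algebra (Rn n \<Otimes>\<^sub>M Rn n))" and snd: "distr \<gamma> (Rn n) snd = P"
    using \<gamma> by (auto simp: couplings_def)
  interpret \<gamma>: prob_space \<gamma> using \<gamma>p by (simp add: space_prob_algebra)
  have sets_\<gamma>[measurable_cong]: "sets \<gamma> = sets (PiM {..<n} (\<lambda>_. borel) \<Otimes>\<^sub>M PiM {..<n} (\<lambda>_. borel))"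
    using \<gamma>p by (simp add: space_prob_algebra Rn_def)
  have F: "(\<lambda>(A, \<xi>). F A \<xi> i) \<in> borel_measurable (G \<Otimes>\<^sub>M N)" if i: "i < k" for i
  proof -
    have [measurable]: "x i \<in> space (PiM {..<n} (\<lambda>_. borel))" using x[OF i] by (simp add: Rn_def)
    have [measurable]: "{z \<in> space (Rn n). 10 * exp 9 * \<rho> \<le> l2_dist n (x i) z} \<in> sets (Rn n)" by measurable
    show ?thesis unfolding F_def by measurable
  qed
  then show "(\<lambda>(A, \<xi>). \<Sum>i<k. F A \<xi> i) \<in> borel_measurable (G \<Otimes>\<^sub>M N)"
    unfolding case_prod_beta' by (intro borel_measurable_sum) auto
  have "(\<integral>\<^sup>+(A, \<xi>). (\<Sum>i<k. F A \<xi> i) \<partial>(G \<Otimes>\<^sub>M N)) = (\<Sum>i<k. \<integral>\<^sup>+(A, \<xi>). F A \<xi> i \<partial>(G \<Otimes>\<^sub>M N))"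
    unfolding case_prod_beta' using F by (intro nn_integral_sum) (auto simp: case_prod_beta')
  also have "\<dots> \<le> (\<Sum>i<k. ennreal (5 * exp (- (real m / 2))))"
  proof (intro sum_mono)
    fix i assume "i \<in> {..<k}"
    then have i: "i < k" by simp
    have "(\<integral>\<^sup>+(A, \<xi>). F A \<xi> i \<partial>(G \<Otimes>\<^sub>M N)) = (\<integral>\<^sup>+A. \<integral>\<^sup>+\<xi>. F A \<xi> i \<partial>N \<partial>G)"
      using N.nn_integral_fst[OF F[OF i]] by simp
    also have "\<dots> \<le> ennreal (5 * exp (- (real m / 2)))"
      unfolding F_def by (rule expected_far_posterior_mass_le[OF \<gamma>p snd x[OF i] \<rho> refl])
    finally show "(\<integral>\<^sup>+(A, \<xi>). F A \<xi> i \<partial>(G \<Otimes>\<^sub>M N)) \<le> ennreal (5 * exp (- (real m / 2)))" .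
  qed
  also have "\<dots> = ennreal (real k * (5 * exp (- (real m / 2))))"
    by (simp add: ennreal_mult ennreal_of_nat_eq_real_of_nat)
  also have "\<dots> \<le> ennreal (exp (real m / 4) * (5 * exp (- (real m / 2))))"
    using k by (intro ennreal_leI mult_right_mono) auto
  also have "\<dots> = ennreal (5 * exp (- (real m / 4)))"
    by (simp add: exp_add[symmetric] mult.left_commute)
  finally show "(\<integral>\<^sup>+(A, \<xi>). (\<Sum>i<k. F A \<xi> i) \<partial>(G \<Otimes>\<^sub>M N)) \<le> ennreal (5 * exp (- (real m / 4)))" .
qed

lemma measurable_emeasure_sampling_law:
  assumes R: "R \<in> space (prob_algebra (Rn n))" and E: "E \<in> sets (Rn n \<Otimes>\<^sub>M Rn n)"
  shows "(\<lambda>(A, \<xi>). emeasure (sampling_law m n \<sigma> R P A \<xi>) E) \<in> borel_measurable (G \<Otimes>\<^sub>M N)"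
proof -
  interpret R: prob_space R using R by (simp add: space_prob_algebra)
  have [measurable_cong]: "sets R = sets (PiM {..<n} (\<lambda>_. borel))"
    using R by (simp add: space_prob_algebra Rn_def)
  have "(\<lambda>(A, \<xi>). emeasure (sampling_law m n \<sigma> R P A \<xi>) E) \<in> borel_measurable (G \<Otimes>\<^sub>M N) \<longleftrightarrow>
    (\<lambda>(A, \<xi>). \<integral>\<^sup>+x. posterior_mass (Pair x -` E) A (obs A \<xi> x) \<partial>R) \<in> borel_measurable (G \<Otimes>\<^sub>M N)"
    by (intro measurable_cong) (auto simp: space_pair_measure emeasure_sampling_law[OF _ _ R E])
  also have \<dots>
    unfolding case_prod_beta'
    by (intro R.borel_measurable_nn_integral, unfold case_prod_beta', rule measurable_posterior_mass_section[OF _ _ _ E])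
      measurable
  finally show ?thesis .
qed

text \<open>With \<open>a = exp (- m / 32)\<close>, Markov's inequality bounds the probability that
  the sum over cells exceeds \<open>a\<close> by \<open>5 exp (- m / 4) / a\<close>, which is at
  most \<open>a\<close>. Whenever the sum is at most \<open>a\<close>, the far pairs have
  probability at most \<open>b + a\<close>.\<close>

lemma posterior_sampling_accurate:
  fixes x :: "nat \<Rightarrow> nat \<Rightarrow> real"
  assumes R: "R \<in> space (prob_algebra (Rn n))" and \<gamma>: "\<gamma> \<in> couplings n R P" and b: "0 \<le> b"
    and covered: "emeasure \<gamma> {w \<in> space \<gamma>. \<not> (\<exists>i<k. l2_dist n (fst w) (snd w) \<le> \<sigma> \<and> l2_dist n (x i) (fst w) \<le> \<rho>)}
      \<le> ennreal b"
    and x: "\<And>i. i < k \<Longrightarrow> x i \<in> space (Rn n)" and \<rho>: "\<sigma> \<le> \<rho>" and k: "real k \<le> exp (real m / 4)"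
  shows "1 - exp (- (1 / 32) * real m) \<le> measure (G \<Otimes>\<^sub>M N) {(A, \<xi>) \<in> space (G \<Otimes>\<^sub>M N).
    measure (sampling_law m n \<sigma> R P A \<xi>) (far_pairs (\<rho> + 10 * exp 9 * \<rho>)) \<le> b + 2 * exp (- (1 / 32) * real m)}"
    (is "_ \<le> measure _ ?good")
proof -
  interpret GN: prob_space "G \<Otimes>\<^sub>M N" by (intro prob_space_pair G.prob_space_axioms N.prob_space_axioms)
  define E where "E = far_pairs (\<rho> + 10 * exp 9 * \<rho>)"
  have E: "E \<in> sets (Rn n \<Otimes>\<^sub>M Rn n)" unfolding E_def by (rule sets_far_pairs)
  define a where "a = exp (- (1 / 32) * real m)"
  have a: "0 < a" by (simp add: a_def)
  define law where "law z = sampling_law m n \<sigma> R P (fst z) (snd z)" for z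
  have good: "?good = {z \<in> space (G \<Otimes>\<^sub>M N). measure (law z) E \<le> b + 2 * a}"
    by (auto simp: E_def a_def law_def)
  have law_prob: "prob_space (law z)" if "z \<in> space (G \<Otimes>\<^sub>M N)" for z
    using that R unfolding law_def by (intro prob_space_sampling_law) (auto simp: space_pair_measure)
  have [measurable]: "(\<lambda>z. emeasure (law z) E) \<in> borel_measurable (G \<Otimes>\<^sub>M N)"
    using measurable_emeasure_sampling_law[OF R E] by (simp add: law_def case_prod_beta')
  have good_sets: "{z \<in> space (G \<Otimes>\<^sub>M N). measure (law z) E \<le> b + 2 * a} \<in> GN.events"
    unfolding measure_def by measurable
  show ?thesis
  \<comment> \<open>If \<open>2 * a\<close> is at least 1, the bound holds for every probability;
    otherwise \<open>a < 1 / 2\<close>, which later absorbs the constant 5.\<close>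
  proof (cases "1 \<le> 2 * a")
    case True
    have "measure (law z) E \<le> b + 2 * a" if "z \<in> space (G \<Otimes>\<^sub>M N)" for z
      using prob_space.prob_le_1[OF law_prob[OF that], of E] True b by simp
    then have "{z \<in> space (G \<Otimes>\<^sub>M N). measure (law z) E \<le> b + 2 * a} = space (G \<Otimes>\<^sub>M N)" by auto
    then show ?thesis unfolding good by (simp add: GN.prob_space)
  next
    case False
    define \<Phi> where "\<Phi> z = (\<Sum>i<k. \<integral>\<^sup>+w. (if l2_dist n (fst w) (snd w) \<le> \<sigma> \<and> l2_dist n (x i) (fst w) \<le> \<rho>
       then posterior_mass {y \<in> space (Rn n). 10 * exp 9 * \<rho> \<le> l2_dist n (x i) y} (fst z) (obs (fst z) (snd z) (fst w)) else 0) \<partial>\<gamma>)" for z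
    have \<Phi>[measurable]: "\<Phi> \<in> borel_measurable (G \<Otimes>\<^sub>M N)"
      and int: "(\<integral>\<^sup>+z. \<Phi> z \<partial>(G \<Otimes>\<^sub>M N)) \<le> ennreal (5 * exp (- (real m / 4)))"
      using expected_cells_le[OF \<gamma> x \<rho> k] by (simp_all add: \<Phi>_def[abs_def] case_prod_beta')
    \<comment> \<open>The failure event is placed in the set to which
      \<open>nn_integral_Markov_inequality\<close> applies, the threshold \<open>a\<close> being
      written as the factor \<open>1 / a\<close>.\<close>
    have bad: "space (G \<Otimes>\<^sub>M N) - {z \<in> space (G \<Otimes>\<^sub>M N). measure (law z) E \<le> b + 2 * a}
        \<subseteq> {z \<in> space (G \<Otimes>\<^sub>M N). 1 \<le> ennreal (1 / a) * \<Phi> z}"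
    proof (rule subsetI, rule ccontr)
      fix z assume "z \<in> space (G \<Otimes>\<^sub>M N) - {z \<in> space (G \<Otimes>\<^sub>M N). measure (law z) E \<le> b + 2 * a}"
        and not_in: "z \<notin> {z \<in> space (G \<Otimes>\<^sub>M N). 1 \<le> ennreal (1 / a) * \<Phi> z}"
      then have z: "z \<in> space (G \<Otimes>\<^sub>M N)" and far: "\<not> measure (law z) E \<le> b + 2 * a" by simp_all
      have gt: "\<not> 1 \<le> ennreal (1 / a) * \<Phi> z" using not_in z by simp
      interpret L: prob_space "law z" using z by (rule law_prob)
      have \<Phi>a: "\<Phi> z \<le> ennreal a"
      proof (rule ccontr)
        assume "\<not> \<Phi> z \<le> ennreal a"
        then have "ennreal (1 / a) * ennreal a \<le> ennreal (1 / a) * \<Phi> z" by (intro mult_left_mono) auto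
        then show False using gt a by (simp add: ennreal_mult'[symmetric])
      qed
      have "emeasure (law z) E \<le> ennreal b + \<Phi> z"
        using z unfolding law_def E_def \<Phi>_def
        by (intro emeasure_sampling_law_far_le[OF _ _ R \<gamma> covered x]) (auto simp: space_pair_measure mem_Times_iff)
      also have "\<dots> \<le> ennreal b + ennreal a" by (rule add_left_mono[OF \<Phi>a])
      also have "\<dots> = ennreal (b + a)" using a b by simp
      finally have "L.prob E \<le> b + a"
        unfolding L.emeasure_eq_measure using a b by (subst (asm) ennreal_le_iff) auto
      then show False using far a by simp
    qed
    \<comment> \<open>The exponent 1/32 makes \<open>exp (- m / 4) = a ^ 8\<close>. Of this,
      \<open>a ^ 6 \<le> 1 / 64\<close> pays for the 5 and \<open>a\<^sup>2\<close> remains, one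
      factor for the threshold and one for the failure probability.\<close>
    have "exp (- (real m / 4)) * 5 \<le> a * a"
    proof -
      have "2 \<le> 1 / a" using False a by (simp add: field_simps)
      then have "2 ^ 6 \<le> (1 / a) ^ 6" by (intro power_mono) auto
      then have "5 * a ^ 6 \<le> 1" using a by (simp add: field_simps)
      then have "5 * a ^ 6 * a\<^sup>2 \<le> 1 * a\<^sup>2" by (intro mult_right_mono) auto
      moreover have "a ^ 6 * a\<^sup>2 = exp (- (real m / 4))"
        by (simp add: a_def exp_of_nat_mult[symmetric] exp_add[symmetric])
      ultimately show ?thesis by (simp add: power2_eq_square)
    qed
    then have small: "1 / a * (5 * exp (- (real m / 4))) \<le> a" using a by (simp add: field_simps)
    have "emeasure (G \<Otimes>\<^sub>M N) (space (G \<Otimes>\<^sub>M N) - {z \<in> space (G \<Otimes>\<^sub>M N). measure (law z) E \<le> b + 2 * a})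
        \<le> emeasure (G \<Otimes>\<^sub>M N) {z \<in> space (G \<Otimes>\<^sub>M N). 1 \<le> ennreal (1 / a) * \<Phi> z}"
      by (rule emeasure_mono[OF bad]) measurable
    also have "\<dots> \<le> ennreal (1 / a) * (\<integral>\<^sup>+z. \<Phi> z * indicator (space (G \<Otimes>\<^sub>M N)) z \<partial>(G \<Otimes>\<^sub>M N))"
      by (rule nn_integral_Markov_inequality) measurable
    also have "(\<integral>\<^sup>+z. \<Phi> z * indicator (space (G \<Otimes>\<^sub>M N)) z \<partial>(G \<Otimes>\<^sub>M N)) = (\<integral>\<^sup>+z. \<Phi> z \<partial>(G \<Otimes>\<^sub>M N))"
      by (intro nn_integral_cong) simp
    also have "ennreal (1 / a) * \<dots> \<le> ennreal (1 / a) * ennreal (5 * exp (- (real m / 4)))"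
      by (rule mult_left_mono[OF int]) simp
    also have "\<dots> \<le> ennreal a"
      using small a by (simp add: ennreal_mult'[symmetric] ennreal_leI)
    finally have "measure (G \<Otimes>\<^sub>M N) (space (G \<Otimes>\<^sub>M N) - {z \<in> space (G \<Otimes>\<^sub>M N). measure (law z) E \<le> b + 2 * a}) \<le> a"
      using a by (simp add: GN.emeasure_eq_measure)
    then show ?thesis unfolding good unfolding a_def[symmetric] using GN.prob_compl[OF good_sets] by simp
  qed
qed

end

section \<open>The choice of constants and the final assembly\<close>

theorem theorem3p4:
  shows "\<exists>c C1 C2 c0 :: real. c > 0 \<and> C1 > 0 \<and> C2 > 0 \<and> c0 > 0 \<and>
    (\<forall>(n :: nat) (m :: nat) (\<delta> :: real) (p :: real) (\<epsilon> :: real) (\<eta> :: real) (\<sigma> :: real)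
       (R :: (nat \<Rightarrow> real) measure) (P :: (nat \<Rightarrow> real) measure).
      m \<ge> 1 \<longrightarrow> 0 \<le> \<delta> \<longrightarrow> \<delta> < 1 / 4 \<longrightarrow> p \<ge> 1 \<longrightarrow> \<epsilon> > 0 \<longrightarrow> \<eta> > 0 \<longrightarrow>
      R \<in> space (prob_algebra (Rn n)) \<longrightarrow> P \<in> space (prob_algebra (Rn n)) \<longrightarrow>
      wasserstein n p R P \<le> ennreal \<epsilon> \<longrightarrow>
      ereal \<sigma> \<ge> ereal C1 * noise_threshold \<epsilon> \<delta> p \<longrightarrow>
      ereal (real m) \<ge> ereal C2 * min (ln_enat (Cov n \<eta> \<delta> R)) (ln_enat (Cov n \<eta> \<delta> P)) \<longrightarrow>
      measure (gaussian_matrix m n \<Otimes>\<^sub>M gaussian_noise m \<sigma>)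
        {(A, \<xi>) \<in> space (gaussian_matrix m n \<Otimes>\<^sub>M gaussian_noise m \<sigma>).
           measure (sampling_law m n \<sigma> R P A \<xi>)
             {(x, xhat) \<in> space (Rn n \<Otimes>\<^sub>M Rn n). l2_dist n x xhat \<ge> c * \<eta> + c * \<sigma>}
           \<le> 2 * \<delta> + 2 * exp (- c0 * real m)}
      \<ge> 1 - exp (- c0 * real m))"
proof (intro exI conjI allI impI)
  \<comment> \<open>\<open>c\<close> adds the cell radius, 1 times \<open>\<eta> + \<sigma>\<close>,
    to the far distance \<open>10 * exp 9\<close> times it. \<open>C1 = 2\<close> pays for a
    coupling of cost below \<open>2 * \<epsilon>\<close>, \<open>C2 = 4\<close> gives at most
    \<open>exp (m / 4)\<close> centres, and \<open>c0 = 1 / 32\<close> comes from the Markov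
    step.\<close>
  show "(0::real) < 1 + 10 * exp 9" by (simp add: add_pos_pos)
  show "(0::real) < 2" "(0::real) < 4" "(0::real) < 1 / 32" by simp_all
next
  fix n m :: nat and \<delta> p \<epsilon> \<eta> \<sigma> :: real and R P :: "(nat \<Rightarrow> real) measure"
  assume m: "1 \<le> m" and \<delta>: "0 \<le> \<delta>" "\<delta> < 1 / 4" and p: "1 \<le> p" and \<epsilon>: "0 < \<epsilon>" and \<eta>: "0 < \<eta>"
    and R: "R \<in> space (prob_algebra (Rn n))" and P: "P \<in> space (prob_algebra (Rn n))"
    and W: "wasserstein n p R P \<le> ennreal \<epsilon>"
    and noise: "ereal 2 * noise_threshold \<epsilon> \<delta> p \<le> ereal \<sigma>"
    and cov: "ereal 4 * min (ln_enat (Cov n \<eta> \<delta> R)) (ln_enat (Cov n \<eta> \<delta> P)) \<le> ereal (real m)"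
  \<comment> \<open>For \<open>\<delta> = 0\<close> the threshold is infinite and no real
    \<open>\<sigma>\<close> exceeds it. Positivity of \<open>\<delta>\<close> then also makes
    \<open>\<sigma>\<close> positive.\<close>
  have "\<delta> \<noteq> 0" using noise by (auto simp: noise_threshold_def)
  then have \<delta>0: "0 < \<delta>" and \<sigma>: "2 * (\<epsilon> / \<delta> powr (1 / p)) \<le> \<sigma>"
    using noise \<delta> by (auto simp: noise_threshold_def)
  have "0 < 2 * (\<epsilon> / \<delta> powr (1 / p))" using \<epsilon> \<delta>0 by simp
  then have \<sigma>0: "0 < \<sigma>" using \<sigma> by linarith
  interpret PS: posterior_sampling m n \<sigma> P using m \<sigma>0 P by unfold_locales
  obtain \<gamma> where \<gamma>: "\<gamma> \<in> couplings n R P"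
    and far: "emeasure \<gamma> {w \<in> space \<gamma>. \<sigma> < l2_dist n (fst w) (snd w)} \<le> ennreal \<delta>"
    by (rule wasserstein_coupling_far_le[OF W \<epsilon> p \<delta>0 \<sigma>])
  \<comment> \<open>The minimum is one of the two logarithms; \<open>Q\<close> is the distribution
    whose covering is used.\<close>
  obtain Q where Q: "Q = R \<or> Q = P" "ereal 4 * ln_enat (Cov n \<eta> \<delta> Q) \<le> ereal (real m)"
    using cov by (metis min_def)
  have "\<delta> < 1" using \<delta> by simp
  then obtain k x where k: "real k \<le> exp (real m / 4)" and x: "\<And>i. i < k \<Longrightarrow> x i \<in> space (Rn n)"
    and ball: "1 - \<delta> \<le> measure Q (\<Union>i<k. l2_ball n (x i) \<eta>)"
    using Cov_obtain[OF Q(2)] by metis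
  have eq: "(1 + 10 * exp 9) * \<eta> + (1 + 10 * exp 9) * \<sigma> = (\<eta> + \<sigma>) + 10 * exp 9 * (\<eta> + \<sigma>)"
    by (simp add: algebra_simps)
  show "1 - exp (- (1 / 32) * real m) \<le> measure (gaussian_matrix m n \<Otimes>\<^sub>M gaussian_noise m \<sigma>)
        {(A, \<xi>) \<in> space (gaussian_matrix m n \<Otimes>\<^sub>M gaussian_noise m \<sigma>).
           measure (sampling_law m n \<sigma> R P A \<xi>)
             {(x, xhat) \<in> space (Rn n \<Otimes>\<^sub>M Rn n). l2_dist n x xhat \<ge> (1 + 10 * exp 9) * \<eta> + (1 + 10 * exp 9) * \<sigma>}
           \<le> 2 * \<delta> + 2 * exp (- (1 / 32) * real m)}"
    unfolding eq
    by (rule PS.posterior_sampling_accurate[OF R \<gamma> _ coupling_covered[OF \<gamma> far _ _ x Q(1) ball] x _ k])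
      (use \<delta> \<sigma>0 \<eta> in simp_all)
qed

end
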